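(* The problem Cycle Graph-Exclusive Vertex Splitting is solvable in polynomial time.
   Context: All graphs are finite, simple and undirected. An exclusive vertex split of a vertex $v$ in a graph $G$ removes $v$ and adds two new vertices $v_1,v_2$ with $N(v_1)\cup N(v_2)=N(v)$ and $N(v_1)\cap N(v_2)=\emptyset$; no other adjacencies change. A cycle graph is a disjoint union of cycles. Cycle Graph-Exclusive Vertex Splitting: given an undirected graph $G$ and a positive integer $k$, decide whether some sequence of at most $k$ exclusive vertex splits transforms $G$ into a cycle graph. *)

theory Defs
  imports Main "HOL-Computational_Algebra.Polynomial"
begin

text \<open>A finite simple graph is a pair of its vertex set and its set of edges, each edge being a two-element
  set of vertices.\<close>

type_synonym 'a graph = "'a set \<times> 'a set set"

abbreviation verts :: "'a graph \<Rightarrow> 'a set" where "verts \<equiv> fst"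
abbreviation edges :: "'a graph \<Rightarrow> 'a set set" where "edges \<equiv> snd"

definition is_graph :: "'a graph \<Rightarrow> bool" where
  "is_graph G \<longleftrightarrow> finite (verts G) \<and> (\<forall>e\<in>edges G. e \<subseteq> verts G \<and> card e = 2)"

definition nbh :: "'a graph \<Rightarrow> 'a \<Rightarrow> 'a set" where
  "nbh G v = {u. {u, v} \<in> edges G}"

definition is_cycle :: "'a graph \<Rightarrow> bool" where
  "is_cycle C \<longleftrightarrow> (\<exists>xs. distinct xs \<and> length xs \<ge> 3 \<and> verts C = set xs \<and>
     edges C = {{xs ! i, xs ! ((i + 1) mod length xs)} |i. i < length xs})"

text \<open>A disjoint union of cycles; the empty union (the graph without vertices) is included.\<close>

definition is_cycle_graph :: "'a graph \<Rightarrow> bool" where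
  "is_cycle_graph G \<longleftrightarrow> (\<exists>\<C>. finite \<C> \<and> (\<forall>C\<in>\<C>. is_cycle C) \<and>
     pairwise (\<lambda>C D. verts C \<inter> verts D = {}) \<C> \<and>
     verts G = (\<Union>C\<in>\<C>. verts C) \<and> edges G = (\<Union>C\<in>\<C>. edges C))"

text \<open>The last conjunct says that all adjacencies not involving the removed or the new vertices
  are unchanged. One of the two new neighbourhoods may be empty.\<close>

definition exclusive_split :: "'a graph \<Rightarrow> 'a graph \<Rightarrow> bool" where
  "exclusive_split G H \<longleftrightarrow> is_graph G \<and> is_graph H \<and>
     (\<exists>v v1 v2. v \<in> verts G \<and> v1 \<notin> verts G \<and> v2 \<notin> verts G \<and> v1 \<noteq> v2 \<and>
        verts H = (verts G - {v}) \<union> {v1, v2} \<and>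
        nbh H v1 \<union> nbh H v2 = nbh G v \<and> nbh H v1 \<inter> nbh H v2 = {} \<and>
        {e \<in> edges H. v1 \<notin> e \<and> v2 \<notin> e} = {e \<in> edges G. v \<notin> e})"

text \<open>Deterministic multi-tape Turing machines. States are the numbers below \<open>num_states\<close> and tape symbols the numbers below
  \<open>num_syms\<close>, with \<open>0\<close> being the blank. Tapes are infinite in both directions. Given the
  current state and the symbols under the heads, \<open>delta\<close> yields the new state and, for each
  tape, the symbol to write and the head movement.\<close>

datatype move = Left | Stay | Right

record tm =
  num_tapes :: nat
  num_syms :: nat
  num_states :: nat
  start :: nat
  accept :: nat
  reject :: nat
  delta :: "nat \<Rightarrow> nat list \<Rightarrow> nat \<times> (nat \<times> move) list"

definition turing_machine :: "tm \<Rightarrow> bool" where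
  "turing_machine M \<longleftrightarrow> num_tapes M \<ge> 1 \<and> num_syms M \<ge> 1 \<and>
     start M < num_states M \<and> accept M < num_states M \<and> reject M < num_states M \<and>
     accept M \<noteq> reject M \<and>
     (\<forall>q ss. q < num_states M \<and> length ss = num_tapes M \<and> set ss \<subseteq> {..<num_syms M} \<longrightarrow>
        (case delta M q ss of (q', as) \<Rightarrow>
           q' < num_states M \<and> length as = num_tapes M \<and> fst ` set as \<subseteq> {..<num_syms M}))"

text \<open>A tape consists of its head position and its contents.\<close>

type_synonym tape = "int \<times> (int \<Rightarrow> nat)"
type_synonym config = "nat \<times> tape list"

fun read :: "tape \<Rightarrow> nat" where
  "read (h, f) = f h"

fun offset :: "move \<Rightarrow> int" where
  "offset Left = -1"
| "offset Stay = 0"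
| "offset Right = 1"

fun act :: "nat \<times> move \<Rightarrow> tape \<Rightarrow> tape" where
  "act (s, d) (h, f) = (h + offset d, f(h := s))"

text \<open>Configurations in the accepting or rejecting state are fixed points.\<close>

fun step :: "tm \<Rightarrow> config \<Rightarrow> config" where
  "step M (q, ts) =
     (if q = accept M \<or> q = reject M then (q, ts)
      else (case delta M q (map read ts) of (q', as) \<Rightarrow> (q', map2 act as ts)))"

definition start_config :: "tm \<Rightarrow> nat list \<Rightarrow> config" where
  "start_config M w =
     (start M,
      (0, \<lambda>i. if 0 \<le> i \<and> i < int (length w) then w ! nat i else 0)
        # replicate (num_tapes M - 1) (0, \<lambda>_. 0))"

text \<open>On every word over the input alphabet, the machine has halted after a number of steps
  that is polynomial in the length of the word, with the correct answer. Input symbols differ from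
  the blank.\<close>

definition polynomial_time_language :: "nat set \<Rightarrow> nat list set \<Rightarrow> bool" where
  "polynomial_time_language \<Sigma> L \<longleftrightarrow> L \<subseteq> lists \<Sigma> \<and>
     (\<exists>M (p :: nat poly). turing_machine M \<and> \<Sigma> \<subseteq> {1..<num_syms M} \<and>
        (\<forall>w\<in>lists \<Sigma>.
           fst ((step M ^^ poly p (length w)) (start_config M w)) =
             (if w \<in> L then accept M else reject M)))"

text \<open>A decision problem is given by its set \<open>I\<close> of instances and its yes-instances \<open>Y\<close>. The
  language \<open>L\<close> consists of the encodings of the yes-instances; words that encode no
  instance are not in \<open>L\<close>.\<close>

definition polynomial_time_solvable ::
    "nat set \<Rightarrow> ('i \<Rightarrow> nat list) \<Rightarrow> 'i set \<Rightarrow> 'i set \<Rightarrow> bool" where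
  "polynomial_time_solvable \<Sigma> enc I Y \<longleftrightarrow>
     (\<exists>L. polynomial_time_language \<Sigma> L \<and> L \<subseteq> enc ` I \<and> (\<forall>x\<in>I. enc x \<in> L \<longleftrightarrow> x \<in> Y))"

text \<open>The problem Cycle Graph-Exclusive Vertex Splitting (CGES). The vertices of input graphs are natural numbers. This covers all finite graphs up to
  isomorphism and always leaves new vertices for the splits.\<close>

definition cges_instances :: "(nat graph \<times> nat) set" where
  "cges_instances = {(G, k). is_graph G \<and> k > 0}"

definition cges_yes :: "(nat graph \<times> nat) set" where
  "cges_yes = {(G, k). \<exists>l\<le>k. \<exists>H. (exclusive_split ^^ l) G H \<and> is_cycle_graph H}"

text \<open>The input alphabet has the bits 0 and 1, written as the symbols \<open>1\<close> and \<open>2\<close>, and a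
  separator, written as \<open>3\<close>.\<close>

definition input_alphabet :: "nat set" where
  "input_alphabet = {1, 2, 3}"

definition bit_sym :: "bool \<Rightarrow> nat" where
  "bit_sym b = (if b then 2 else 1)"

text \<open>Binary representation, most significant bit first.\<close>

fun binary :: "nat \<Rightarrow> nat list" where
  "binary n = (if n = 0 then [] else binary (n div 2) @ [bit_sym (odd n)])"

declare binary.simps [simp del]

text \<open>The strictly lower triangle of the adjacency matrix, row by row and with a separator
  after each row, for the vertices in increasing order.\<close>

definition encode_graph :: "nat graph \<Rightarrow> nat list" where
  "encode_graph G = (let vs = sorted_list_of_set (verts G) in
     concat (map (\<lambda>i. map (\<lambda>j. bit_sym ({vs ! i, vs ! j} \<in> edges G)) [0..<i] @ [3])
       [0..<length vs]))"

definition cges_encode :: "nat graph \<times> nat \<Rightarrow> nat list" where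
  "cges_encode = (\<lambda>(G, k). binary k @ [3] @ encode_graph G)"

end

theory Submission imports Defs begin

text \<open>A split distributes the degree of a vertex over two vertices and keeps all other degrees. As the
  2-regular graphs are exactly the cycle graphs, a graph with $n$ vertices and $m$ edges can be split into one iff all its
  degrees are even and positive; a vertex of degree $d$ then has to be split $d/2 - 1$ times, which amounts to
  $m - n$ splits in total. So one has to check the degrees and that $m \le n + k$.

  A machine with three tapes does so in quadratic time. It keeps the class (zero, odd,
  even and positive) of the degree of each vertex on the second tape and $m$ in unary on the third; since row $i$ of the
  triangular matrix must end exactly where the list of the first $i$ classes ends, this also
  checks the format of the input. Finally it removes $n$ from the unary number and counts the rest
  down simultaneously with $k$.\<close>

subsection \<open>Splitting into 2-regular graphs\<close>

text \<open>The number of edges is handled as half the degree sum, which splitting preserves while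
  each split adds one vertex; so the number of splits is forced and only its comparison with
  \<open>k\<close> remains. As \<open>k\<close> is given in binary, it may be exponential in the
  input length, whereas the number of edges is bounded by that length. Hence the unary number drives
  the final countdown, and \<open>k\<close> is decremented in place, each time at a cost linear in
  its number of bits. Runs of the machine are verified backwards: most lemmas take the verdict of
  the remaining run, with its time bound, as a hypothesis and prepend one phase, so that phases
  compose by rule application.\<close>

lemma nbh_sym: "u \<in> nbh G v \<longleftrightarrow> v \<in> nbh G u"
  by (simp add: nbh_def insert_commute)

lemma nbh_in_verts: "is_graph G \<Longrightarrow> u \<in> nbh G v \<Longrightarrow> u \<in> verts G \<and> v \<in> verts G \<and> u \<noteq> v"
  by (fastforce simp: nbh_def is_graph_def)

lemma finite_nbh: "is_graph G \<Longrightarrow> finite (nbh G v)"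
  by (meson finite_subset is_graph_def nbh_in_verts subsetI)

section \<open>Cycle graphs are the 2-regular graphs\<close>

definition two_regular :: "'a graph \<Rightarrow> bool" where
  "two_regular G \<longleftrightarrow> is_graph G \<and> (\<forall>v\<in>verts G. card (nbh G v) = 2)"

definition even_degrees :: "'a graph \<Rightarrow> bool" where
  "even_degrees G \<longleftrightarrow> is_graph G \<and> (\<forall>v\<in>verts G. even (card (nbh G v)) \<and> card (nbh G v) > 0)"

definition degree_sum :: "'a graph \<Rightarrow> nat" where
  "degree_sum G = (\<Sum>v\<in>verts G. card (nbh G v))"

lemma mod_Suc_pred:
  fixes i n :: nat
  assumes "i < n"
  shows "Suc ((i + (n - 1)) mod n) mod n = i"
  using assms by (simp add: mod_Suc_eq)

lemma two_regular_cycle: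
  assumes "is_cycle C"
  shows "two_regular C"
proof -
  from assms obtain xs where xs: "distinct xs" "length xs \<ge> 3" "verts C = set xs"
    and E: "edges C = {{xs ! i, xs ! ((i + 1) mod length xs)} |i. i < length xs}"
    unfolding is_cycle_def by blast
  define n where "n = length xs"
  have n: "n \<ge> 3" "n > 0" using xs n_def by auto
  have eq: "xs ! i = xs ! j \<longleftrightarrow> i = j" if "i < n" "j < n" for i j
    using that xs(1) by (simp add: n_def nth_eq_iff_index_eq)
  have "is_graph C"
  proof -
    have "xs ! i \<noteq> xs ! ((i + 1) mod n)" if "i < n" for i
    proof -
      have "i \<noteq> (i + 1) mod n"
        using that n by (cases "i + 1 = n") auto
      then show ?thesis using eq[of i "(i + 1) mod n"] that n by simp
    qed
    then show ?thesis
      using xs n by (auto simp: is_graph_def E n_def)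
  qed
  moreover have "card (nbh C v) = 2" if "v \<in> verts C" for v
  proof -
    from that obtain i where i: "i < n" "v = xs ! i"
      by (auto simp: xs n_def in_set_conv_nth)
    define s where "s = (i + 1) mod n"
    \<comment> \<open>The cyclic predecessor; \<open>i - 1\<close> would be truncated at
      \<open>i = 0\<close>.\<close>
    define p where "p = (i + (n - 1)) mod n"
    have sp: "s < n" "p < n" using n by (auto simp: s_def p_def)
    have ps: "(p + 1) mod n = i" using mod_Suc_pred[OF i(1)] by (simp add: p_def)
    \<comment> \<open>Predecessor and successor are \<open>n - 2\<close> apart modulo
      \<open>n\<close>, and \<open>0 < n - 2 < n\<close>.\<close>
    have "s \<noteq> p"
    proof
      assume "s = p"
      moreover have "i + (n - 1) = i + 1 + (n - 2)" using n by simp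
      ultimately have "(i + 1) mod n = (i + 1 + (n - 2)) mod n" unfolding s_def p_def by (simp only:)
      then have "n dvd n - 2"
        by (metis add_diff_cancel_left' le_add1 mod_eq_dvd_iff_nat)
      then show False using n by (auto dest: dvd_imp_le)
    qed
    have pred: "j = p" if "j < n" "(j + 1) mod n = i" for j
    proof -
      have "(p + 1) mod n = (j + 1) mod n" using ps that by simp
      then show ?thesis using sp that
        by (cases "p + 1 = n"; cases "j + 1 = n") auto
    qed
    have "nbh C v = {xs ! s, xs ! p}"
    proof (intro equalityI subsetI)
      fix u assume "u \<in> nbh C v"
      then obtain j where j: "j < n" "{u, v} = {xs ! j, xs ! ((j + 1) mod n)}"
        by (auto simp: nbh_def E n_def)
      then consider "v = xs ! j" "u = xs ! ((j + 1) mod n)" | "u = xs ! j" "v = xs ! ((j + 1) mod n)"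
        by (auto simp: doubleton_eq_iff)
      then show "u \<in> {xs ! s, xs ! p}"
      proof cases
        case 1
        then have "i = j" using eq[of i j] i j by simp
        then show ?thesis using 1 by (simp add: s_def)
      next
        case 2
        have "(j + 1) mod n < n" using n by (intro mod_less_divisor)
        moreover have "xs ! ((j + 1) mod n) = xs ! i" using 2 i by metis
        ultimately have "(j + 1) mod n = i" using eq i by blast
        then show ?thesis using pred[OF j(1)] 2 by blast
      qed
    next
      fix u assume "u \<in> {xs ! s, xs ! p}"
      then show "u \<in> nbh C v"
      proof
        assume "u = xs ! s"
        then have "{u, v} = {xs ! i, xs ! ((i + 1) mod length xs)}"
          by (auto simp: s_def i n_def)
        then show ?thesis using i by (auto simp: nbh_def E n_def)
      next
        assume "u \<in> {xs ! p}"
        then have "{u, v} = {xs ! p, xs ! ((p + 1) mod length xs)}"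
          using ps by (simp add: i n_def)
        then show ?thesis using sp by (auto simp: nbh_def E n_def)
      qed
    qed
    moreover have "xs ! s \<noteq> xs ! p" using eq sp \<open>s \<noteq> p\<close> by blast
    ultimately show ?thesis by simp
  qed
  ultimately show ?thesis by (simp add: two_regular_def)
qed

text \<open>As the cycles are disjoint, all edges at a vertex come from the one cycle containing
  it.\<close>

lemma two_regular_cycle_graph:
  assumes "is_cycle_graph G"
  shows "two_regular G"
proof -
  from assms obtain \<C> where fin: "finite \<C>" and cyc: "\<forall>C\<in>\<C>. is_cycle C"
    and disj: "pairwise (\<lambda>C D. verts C \<inter> verts D = {}) \<C>"
    and V: "verts G = (\<Union>C\<in>\<C>. verts C)" and E: "edges G = (\<Union>C\<in>\<C>. edges C)"
    unfolding is_cycle_graph_def by blast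
  have reg: "two_regular C" if "C \<in> \<C>" for C using cyc that two_regular_cycle by blast
  have "finite (verts C)" "\<forall>e\<in>edges C. e \<subseteq> verts C \<and> card e = 2" if "C \<in> \<C>" for C
    using reg[OF that] by (auto simp: is_graph_def two_regular_def)
  then have "is_graph G"
    using fin unfolding is_graph_def V E by blast
  moreover have "card (nbh G v) = 2" if "v \<in> verts G" for v
  proof -
    from that obtain C where C: "C \<in> \<C>" "v \<in> verts C" by (auto simp: V)
    have "D = C" if D: "D \<in> \<C>" "u \<in> nbh D v" for D u
    proof (rule ccontr)
      assume "D \<noteq> C"
      have "is_graph D" using reg D(1) by (simp add: two_regular_def)
      from nbh_in_verts[OF this D(2)] have "v \<in> verts D" by simp
      moreover have "verts D \<inter> verts C = {}" using pairwiseD[OF disj D(1) C(1) \<open>D \<noteq> C\<close>] .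
      ultimately show False using C(2) by blast
    qed
    then have "nbh G v = nbh C v"
      using C by (auto simp: nbh_def E)
    then show ?thesis using reg C by (simp add: two_regular_def)
  qed
  ultimately show ?thesis by (simp add: two_regular_def)
qed

definition simple_path :: "'a graph \<Rightarrow> 'a list \<Rightarrow> bool" where
  "simple_path G xs \<longleftrightarrow> distinct xs \<and> set xs \<subseteq> verts G \<and>
     (\<forall>i. Suc i < length xs \<longrightarrow> xs ! i \<in> nbh G (xs ! Suc i))"

text \<open>Determines the neighbourhood of a vertex of degree 2 from two known neighbours.\<close>

lemma card_2_eq: "card S = 2 \<Longrightarrow> a \<in> S \<Longrightarrow> b \<in> S \<Longrightarrow> a \<noteq> b \<Longrightarrow> S = {a, b}"
  by (auto simp: card_2_iff)

lemma simple_path_snoc: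
  assumes "simple_path G xs" "xs \<noteq> []" "u \<in> verts G" "u \<notin> set xs" "u \<in> nbh G (last xs)"
  shows "simple_path G (xs @ [u])"
proof -
  have "(xs @ [u]) ! i \<in> nbh G ((xs @ [u]) ! Suc i)" if "Suc i < length (xs @ [u])" for i
  proof (cases "Suc i < length xs")
    case True
    then show ?thesis using assms by (simp add: simple_path_def nth_append)
  next
    case False
    then have "i = length xs - 1" "Suc i = length xs" using that by auto
    then show ?thesis using assms nbh_sym[of u G "last xs"] by (simp add: nth_append last_conv_nth)
  qed
  then show ?thesis using assms by (auto simp: simple_path_def)
qed

text \<open>The end of a longest path has no neighbour outside the path, and its second neighbour can only be the
  start, as the inner vertices already have two neighbours.\<close>

lemma two_regular_has_cycle:
  assumes "two_regular G" "verts G \<noteq> {}"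
  obtains xs where "distinct xs" "length xs \<ge> 3" "set xs \<subseteq> verts G"
    "\<And>i. i < length xs \<Longrightarrow> {xs ! i, xs ! ((i + 1) mod length xs)} \<in> edges G"
    "\<And>u v. u \<in> nbh G v \<Longrightarrow> v \<in> set xs \<Longrightarrow>
      \<exists>i<length xs. {u, v} = {xs ! i, xs ! ((i + 1) mod length xs)}"
proof -
  have gr: "is_graph G" and deg: "\<And>v. v \<in> verts G \<Longrightarrow> card (nbh G v) = 2"
    using assms(1) by (auto simp: two_regular_def)
  obtain v0 where "v0 \<in> verts G" using assms(2) by auto
  then have "simple_path G [v0]" by (simp add: simple_path_def)
  moreover have "length xs \<le> card (verts G)" if "simple_path G xs" for xs
    using that gr by (metis card_mono distinct_card is_graph_def simple_path_def)
  ultimately have "\<exists>xs. simple_path G xs \<and> (\<forall>ys. simple_path G ys \<longrightarrow> length ys \<le> length xs)"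
    by (intro ex_has_greatest_nat[of _ "[v0]" _ "Suc (card (verts G))"]) (auto simp: less_Suc_eq_le)
  then obtain xs where xs: "simple_path G xs"
    and max: "\<And>ys. simple_path G ys \<Longrightarrow> length ys \<le> length xs"
    by auto
  define n where "n = length xs"
  have n1: "n \<ge> 1" using max[OF \<open>simple_path G [v0]\<close>] by (simp add: n_def)
  have ne: "xs \<noteq> []" using n1 by (auto simp: n_def)
  have dist: "distinct xs" and sub: "set xs \<subseteq> verts G" using xs by (auto simp: simple_path_def)
  have adj: "xs ! i \<in> nbh G (xs ! Suc i)" "xs ! Suc i \<in> nbh G (xs ! i)" if "Suc i < n" for i
    using xs that nbh_sym[of "xs ! i" G "xs ! Suc i"] by (auto simp: simple_path_def n_def)
  have eq: "xs ! i = xs ! j \<longleftrightarrow> i = j" if "i < n" "j < n" for i j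
    using that dist by (simp add: n_def nth_eq_iff_index_eq)
  have inV: "xs ! i \<in> verts G" if "i < n" for i using that sub by (auto simp: n_def)
  define y where "y = xs ! (n - 1)"
  have y: "y = last xs" using ne by (simp add: y_def n_def last_conv_nth)
  have ymem: "\<exists>j<n-1. u = xs ! j" if "u \<in> nbh G y" for u
  proof -
    have "u \<in> verts G" "u \<noteq> y" using nbh_in_verts[OF gr that] by auto
    have "u \<in> set xs"
    proof (rule ccontr)
      assume "u \<notin> set xs"
      then have "simple_path G (xs @ [u])"
        using simple_path_snoc[OF xs ne \<open>u \<in> verts G\<close>] that y by auto
      then show False using max by fastforce
    qed
    then obtain j where "j < n" "u = xs ! j" by (auto simp: in_set_conv_nth n_def)
    moreover have "j \<noteq> n - 1" using \<open>u \<noteq> y\<close> calculation by (auto simp: y_def)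
    ultimately show ?thesis by (intro exI[of _ j]) auto
  qed
  have cy: "card (nbh G y) = 2" using deg inV n1 by (simp add: y_def)
  have inner: "nbh G (xs ! i) = {xs ! (i - 1), xs ! (i + 1)}" if "0 < i" "i < n - 1" for i
    using that adj(1)[of "i - 1"] adj(1,2)[of i] adj(2)[of "i-1"] eq[of "i - 1" "i + 1"] deg inV
    by (intro card_2_eq) auto
  have y0: "xs ! 0 \<in> nbh G y" and n3: "n \<ge> 3"
  proof -
    obtain a b where ab: "nbh G y = {a, b}" "a \<noteq> b" using cy by (auto simp: card_2_iff)
    then obtain i j where ij: "i < n - 1" "a = xs ! i" "j < n - 1" "b = xs ! j"
      using ymem by (metis insertI1 insertI2)
    then show "n \<ge> 3" using ab by (cases "i = j") auto
    \<comment> \<open>An inner vertex is adjacent only to its path neighbours, so \<open>y\<close>,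
      at position \<open>n - 1\<close>, can be one of them only if \<open>m = n - 2\<close>.\<close>
    have end_or: "m = 0 \<or> m = n - 2" if "m < n - 1" "xs ! m \<in> nbh G y" for m
    proof (rule ccontr)
      assume m: "\<not> (m = 0 \<or> m = n - 2)"
      then have "y \<in> {xs ! (m - 1), xs ! (m + 1)}"
        using inner[of m] that nbh_sym[of "xs ! m" G y] by auto
      then show False using eq[of "n - 1" "m - 1"] eq[of "n - 1" "m + 1"] m that by (auto simp: y_def)
    qed
    \<comment> \<open>The two distinct neighbours of \<open>y\<close> occupy both admissible
      positions, so one of them is the start.\<close>
    from end_or ab ij have "i = 0 \<or> i = n - 2" "j = 0 \<or> j = n - 2" by auto
    then show "xs ! 0 \<in> nbh G y" using ab ij by (elim disjE) auto
  qed
  have first: "nbh G (xs ! 0) = {xs ! 1, y}"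
    using adj(2)[of 0] n3 y0 nbh_sym[of y G "xs ! 0"] eq[of 1 "n - 1"] deg[OF inV[of 0]]
    by (intro card_2_eq) (auto simp: y_def)
  have last: "nbh G y = {xs ! 0, xs ! (n - 2)}"
    using adj(1)[of "n - 2"] n3 y0 eq[of 0 "n - 2"] cy
    by (intro card_2_eq) (auto simp: y_def Suc_diff_Suc numeral_2_eq_2)
  show thesis
  proof
    show "{xs ! i, xs ! ((i + 1) mod length xs)} \<in> edges G" if "i < length xs" for i
    proof (cases "i = n - 1")
      case True
      then show ?thesis using y0 n3 by (simp add: nbh_def y_def n_def[symmetric] insert_commute)
    next
      case False
      then show ?thesis using that adj(1)[of i] by (simp add: n_def nbh_def)
    qed
    show "\<exists>i<length xs. {u, v} = {xs ! i, xs ! ((i + 1) mod length xs)}"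
      if u: "u \<in> nbh G v" and v: "v \<in> set xs" for u v
    proof -
      obtain i where i: "i < n" "v = xs ! i" using v by (auto simp: in_set_conv_nth n_def)
      consider "i = 0" | "i = n - 1" | "0 < i" "i < n - 1" using i by linarith
      then have "\<exists>j<n. {u, v} = {xs ! j, xs ! ((j + 1) mod n)}"
      proof cases
        case 1
        then have "u = xs ! 1 \<or> u = y" using first u i by auto
        then show ?thesis
        proof
          assume "u = xs ! 1"
          then show ?thesis using 1 i n3 by (intro exI[of _ 0]) auto
        next
          assume "u = y"
          then show ?thesis using 1 i n3 by (intro exI[of _ "n - 1"]) (auto simp: y_def)
        qed
      next
        case 2
        then have "u = xs ! 0 \<or> u = xs ! (n - 2)" using last u i by (auto simp: y_def)
        then show ?thesis
        proof
          assume "u = xs ! 0"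
          then show ?thesis using 2 i n3 by (intro exI[of _ "n - 1"]) (auto simp: y_def)
        next
          assume "u = xs ! (n - 2)"
          moreover have "(n - 2 + 1) mod n = n - 1" using n3 by simp
          ultimately show ?thesis using 2 i n3 by (intro exI[of _ "n - 2"]) auto
        qed
      next
        case 3
        then have "u = xs ! (i - 1) \<or> u = xs ! (i + 1)" using inner u i by auto
        then show ?thesis
        proof
          assume "u = xs ! (i - 1)"
          then show ?thesis using 3 i by (intro exI[of _ "i - 1"]) auto
        next
          assume "u = xs ! (i + 1)"
          then show ?thesis using 3 i by (intro exI[of _ i]) auto
        qed
      qed
      then show ?thesis by (simp add: n_def)
    qed
  qed (use dist sub n3 n_def in auto)
qed

text \<open>Strong induction on the number of vertices. The cycle from
  \<open>two_regular_has_cycle\<close> contains all edges at its vertices, so it is a whole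
  component, and deleting it changes no remaining degree.\<close>

lemma cycle_graph_two_regular:
  assumes "two_regular G"
  shows "is_cycle_graph G"
  using assms
proof (induction "card (verts G)" arbitrary: G rule: less_induct)
  case less
  show ?case
  proof (cases "verts G = {}")
    case True
    then have "edges G = {}" using less.prems by (fastforce simp: two_regular_def is_graph_def)
    then show ?thesis using True unfolding is_cycle_graph_def by (intro exI[of _ "{}"]) auto
  next
    case False
    have gr: "is_graph G" using less.prems by (simp add: two_regular_def)
    obtain xs where xs: "distinct xs" "length xs \<ge> 3" "set xs \<subseteq> verts G"
      and E: "\<And>i. i < length xs \<Longrightarrow> {xs ! i, xs ! ((i + 1) mod length xs)} \<in> edges G"
      and cl: "\<And>u v. u \<in> nbh G v \<Longrightarrow> v \<in> set xs \<Longrightarrow>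
        \<exists>i<length xs. {u, v} = {xs ! i, xs ! ((i + 1) mod length xs)}"
      using two_regular_has_cycle[OF less.prems False] by metis
    define C where "C = (set xs, {{xs ! i, xs ! ((i + 1) mod length xs)} |i. i < length xs})"
    define H where "H = (verts G - set xs, {e \<in> edges G. e \<inter> set xs = {}})"
    have "is_cycle C" unfolding is_cycle_def C_def using xs by auto
    have closed: "u \<in> set xs" if "u \<in> nbh G v" "v \<in> set xs" for u v
    proof -
      obtain i where "i < length xs" "{u, v} = {xs ! i, xs ! ((i + 1) mod length xs)}"
        using cl[OF \<open>u \<in> nbh G v\<close> \<open>v \<in> set xs\<close>] by blast
      moreover have "(i + 1) mod length xs < length xs" using calculation(1) by (intro mod_less_divisor) auto
      ultimately have "{u, v} \<subseteq> set xs" by auto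
      then show ?thesis by auto
    qed
    have "nbh H v = nbh G v" if "v \<in> verts H" for v
    proof -
      have "v \<notin> set xs" using that by (simp add: H_def)
      moreover have "u \<notin> set xs" if "u \<in> nbh G v" for u
        using closed[of v u] that calculation nbh_sym[of u G v] by blast
      ultimately show ?thesis by (auto simp: H_def nbh_def)
    qed
    then have "two_regular H"
      using less.prems by (auto simp: two_regular_def is_graph_def H_def)
    moreover have "card (verts H) < card (verts G)"
    proof (rule psubset_card_mono)
      have "xs \<noteq> []" using xs(2) by auto
      then show "verts H \<subset> verts G" using xs(3) by (cases xs) (auto simp: H_def)
    qed (use gr in \<open>simp add: is_graph_def\<close>)
    ultimately have "is_cycle_graph H" using less.hyps by blast
    then obtain \<C> where fin: "finite \<C>" and cyc: "\<forall>C\<in>\<C>. is_cycle C"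
      and disj: "pairwise (\<lambda>C D. verts C \<inter> verts D = {}) \<C>"
      and V: "verts H = (\<Union>C\<in>\<C>. verts C)" and EH: "edges H = (\<Union>C\<in>\<C>. edges C)"
      unfolding is_cycle_graph_def by blast
    have "edges G = edges C \<union> edges H"
    proof (intro equalityI subsetI)
      fix e assume e: "e \<in> edges G"
      show "e \<in> edges C \<union> edges H"
      proof (cases "e \<inter> set xs = {}")
        case True
        then show ?thesis using e by (simp add: H_def)
      next
        case False
        then obtain v where v: "v \<in> e" "v \<in> set xs" by auto
        have "card e = 2" using e gr by (simp add: is_graph_def)
        then obtain u where u: "e = {u, v}" using v(1) by (auto simp: card_2_iff)
        then have "u \<in> nbh G v" using e by (simp add: nbh_def)
        then show ?thesis using cl[OF _ v(2)] u unfolding C_def by force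
      qed
    next
      fix e assume "e \<in> edges C \<union> edges H"
      then show "e \<in> edges G" using E by (auto simp: C_def H_def)
    qed
    moreover have "verts G = verts C \<union> verts H" using xs by (auto simp: C_def H_def)
    moreover have "verts C \<inter> verts H = {}" by (auto simp: C_def H_def)
    then have "pairwise (\<lambda>C D. verts C \<inter> verts D = {}) (insert C \<C>)"
      unfolding pairwise_insert V using disj by blast
    ultimately show ?thesis unfolding is_cycle_graph_def
      using fin cyc V EH \<open>is_cycle C\<close>
      by (intro exI[of _ "insert C \<C>"]) simp
  qed
qed

section \<open>Degrees under exclusive splits\<close>

text \<open>Exposes the three vertices that \<open>exclusive_split\<close> hides behind a
  quantifier, so that degrees can be tracked vertex by vertex.\<close>

definition split_into :: "'a graph \<Rightarrow> 'a graph \<Rightarrow> 'a \<Rightarrow> 'a \<Rightarrow> 'a \<Rightarrow> bool" where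
  "split_into G H v v1 v2 \<longleftrightarrow> is_graph G \<and> is_graph H \<and>
     v \<in> verts G \<and> v1 \<notin> verts G \<and> v2 \<notin> verts G \<and> v1 \<noteq> v2 \<and>
     verts H = (verts G - {v}) \<union> {v1, v2} \<and>
     nbh H v1 \<union> nbh H v2 = nbh G v \<and> nbh H v1 \<inter> nbh H v2 = {} \<and>
     {e \<in> edges H. v1 \<notin> e \<and> v2 \<notin> e} = {e \<in> edges G. v \<notin> e}"

lemma exclusive_split_iff: "exclusive_split G H \<longleftrightarrow> (\<exists>v v1 v2. split_into G H v v1 v2)"
  by (simp add: exclusive_split_def split_into_def)

context
  fixes G H :: "'a graph" and v v1 v2 :: 'a
  assumes split: "split_into G H v v1 v2"
begin

text \<open>A neighbour of \<open>v\<close> becomes adjacent to exactly one of \<open>v1\<close> and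
  \<open>v2\<close>, since the new neighbourhoods are disjoint and cover the old one; all its other
  adjacencies persist.\<close>

lemma split_degree_other:
  assumes "u \<in> verts G" "u \<noteq> v"
  shows "card (nbh H u) = card (nbh G u)"
proof -
  have gr: "is_graph G" "is_graph H" and new: "v1 \<notin> verts G" "v2 \<notin> verts G" "v1 \<noteq> v2"
    and un: "nbh H v1 \<union> nbh H v2 = nbh G v" and int: "nbh H v1 \<inter> nbh H v2 = {}"
    and E: "{e \<in> edges H. v1 \<notin> e \<and> v2 \<notin> e} = {e \<in> edges G. v \<notin> e}"
    using split by (auto simp: split_into_def)
  have u: "u \<noteq> v1" "u \<noteq> v2" using assms new by auto
  have "w \<in> nbh H u - {v1, v2} \<longleftrightarrow> w \<in> nbh G u - {v}" for w
  proof -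
    have "{w, u} \<in> {e \<in> edges H. v1 \<notin> e \<and> v2 \<notin> e} \<longleftrightarrow> {w, u} \<in> {e \<in> edges G. v \<notin> e}"
      using E by simp
    then show ?thesis using u assms(2) by (auto simp: nbh_def)
  qed
  then have rest: "nbh H u - {v1, v2} = nbh G u - {v}" by blast
  have "card (nbh H u \<inter> {v1, v2}) = card (nbh G u \<inter> {v})"
  proof (cases "v \<in> nbh G u")
    case True
    then have "v1 \<in> nbh H u \<or> v2 \<in> nbh H u" "\<not> (v1 \<in> nbh H u \<and> v2 \<in> nbh H u)"
      using un int nbh_sym[of _ _ u] by auto
    then show ?thesis using True by auto
  next
    case False
    then have "v1 \<notin> nbh H u" "v2 \<notin> nbh H u"
      using un nbh_sym[of _ _ u] by auto
    then show ?thesis using False by auto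
  qed
  then show ?thesis
    using card_Int_Diff[OF finite_nbh[OF gr(2)], of u "{v1, v2}"]
      card_Int_Diff[OF finite_nbh[OF gr(1)], of u "{v}"] rest by simp
qed

lemma split_degree: "card (nbh G v) = card (nbh H v1) + card (nbh H v2)"
proof -
  have "is_graph H" "nbh H v1 \<union> nbh H v2 = nbh G v" "nbh H v1 \<inter> nbh H v2 = {}"
    using split by (auto simp: split_into_def)
  then show ?thesis by (metis card_Un_disjoint finite_nbh)
qed

lemma split_card_verts: "card (verts H) = Suc (card (verts G))"
proof -
  have "finite (verts G)" "v \<in> verts G" "v1 \<notin> verts G" "v2 \<notin> verts G" "v1 \<noteq> v2"
    and V: "verts H = insert v1 (insert v2 (verts G - {v}))"
    using split by (auto simp: split_into_def is_graph_def)
  then show ?thesis using card_Suc_Diff1[of "verts G" v] by simp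
qed

lemma split_degree_sum: "degree_sum H = degree_sum G"
proof -
  have fin: "finite (verts G)" "v \<in> verts G" "v1 \<notin> verts G" "v2 \<notin> verts G" "v1 \<noteq> v2"
    and V: "verts H = insert v1 (insert v2 (verts G - {v}))"
    using split by (auto simp: split_into_def is_graph_def)
  have "degree_sum H = card (nbh G v) + (\<Sum>u\<in>verts G - {v}. card (nbh H u))"
    using fin by (simp add: degree_sum_def V split_degree)
  also have "\<dots> = card (nbh G v) + (\<Sum>u\<in>verts G - {v}. card (nbh G u))"
    by (simp add: split_degree_other)
  also have "\<dots> = degree_sum G"
    using fin by (simp add: degree_sum_def sum.remove)
  finally show ?thesis .
qed

text \<open>From left to right, this carries the degree condition back to the graph before the
  split; from right to left, it tells which splits preserve it. The parity at \<open>v2\<close>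
  follows from those at \<open>v\<close> and \<open>v1\<close>, by
  \<open>split_degree\<close>.\<close>

lemma split_even_degrees_iff:
  "even_degrees H \<longleftrightarrow> even_degrees G \<and> even (card (nbh H v1)) \<and> card (nbh H v1) > 0 \<and> card (nbh H v2) > 0"
proof -
  have "is_graph G" "is_graph H" "v \<in> verts G"
    and V: "verts H = insert v1 (insert v2 (verts G - {v}))"
    using split by (auto simp: split_into_def)
  then have "even_degrees G \<longleftrightarrow> even (card (nbh G v)) \<and> card (nbh G v) > 0 \<and>
      (\<forall>u\<in>verts G - {v}. even (card (nbh H u)) \<and> card (nbh H u) > 0)"
    using split_degree_other by (auto simp: even_degrees_def)
  then show ?thesis
    using \<open>is_graph H\<close> V by (auto simp: even_degrees_def split_degree)
qed

end

text \<open>A 2-regular \<open>H\<close> has degree sum \<open>2 * card (verts H)\<close>, and the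
  \<open>l\<close> splits have added \<open>l\<close> vertices.\<close>

lemma exclusive_split_degrees:
  assumes "(exclusive_split ^^ l) G H" "two_regular H"
  shows "even_degrees G \<and> degree_sum G = 2 * (card (verts G) + l)"
  using assms
proof (induction l arbitrary: G)
  case 0
  then show ?case by (auto simp: even_degrees_def two_regular_def degree_sum_def)
next
  case (Suc l)
  then obtain K where K: "exclusive_split G K" "(exclusive_split ^^ l) K H"
    by (metis relpowp_Suc_D2)
  then obtain v v1 v2 where "split_into G K v v1 v2"
    by (auto simp: exclusive_split_iff)
  with Suc.IH[OF K(2) Suc.prems(2)] show ?case
    by (simp add: split_even_degrees_iff split_degree_sum split_card_verts)
qed

text \<open>Finiteness of the graph and infinity of the vertex type supply the new vertices; how the
  neighbours are shared out is free.\<close>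

lemma split_into_exists:
  fixes G :: "'a graph"
  assumes "infinite (UNIV :: 'a set)" "is_graph G" "v \<in> verts G" "A \<subseteq> nbh G v"
  obtains H v1 v2 where "split_into G H v v1 v2" "nbh H v1 = A" "nbh H v2 = nbh G v - A"
proof -
  have fin: "finite (verts G)" using assms by (simp add: is_graph_def)
  obtain v1 where v1: "v1 \<notin> verts G" using ex_new_if_finite[OF assms(1) fin] by blast
  obtain v2 where v2: "v2 \<notin> insert v1 (verts G)"
    using ex_new_if_finite[OF assms(1)] fin by (metis finite_insert)
  have N: "u \<in> verts G \<and> u \<noteq> v \<and> u \<noteq> v1 \<and> u \<noteq> v2" if "u \<in> nbh G v" for u
    using nbh_in_verts[OF assms(2) that] v1 v2 by auto
  have vE: "e \<subseteq> verts G \<and> card e = 2" if "e \<in> edges G" for e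
    using that assms(2) by (simp add: is_graph_def)
  then have newE: "v1 \<notin> e" "v2 \<notin> e" if "e \<in> edges G" for e
    using that v1 v2 by blast+
  define H where "H = ((verts G - {v}) \<union> {v1, v2}, {e \<in> edges G. v \<notin> e} \<union>
    ((\<lambda>u. {u, v1}) ` A \<union> (\<lambda>u. {u, v2}) ` (nbh G v - A)))"
  have "is_graph H"
    using fin vE N assms(4) by (auto simp: is_graph_def H_def)
  moreover have n1: "nbh H v1 = A"
    using newE N v2 assms(4) by (fastforce simp: nbh_def H_def doubleton_eq_iff)
  moreover have n2: "nbh H v2 = nbh G v - A"
  proof -
    have "u \<in> nbh H v2 \<longleftrightarrow> u \<in> nbh G v - A" for u
    proof -
      have "{u, v2} \<notin> edges G" using newE by blast
      moreover have "{u, v2} \<notin> (\<lambda>u. {u, v1}) ` A"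
        using N v2 assms(4) by (auto simp: doubleton_eq_iff)
      moreover have "{u, v2} \<in> (\<lambda>u. {u, v2}) ` (nbh G v - A) \<longleftrightarrow> u \<in> nbh G v - A"
        by (auto simp: doubleton_eq_iff)
      ultimately show ?thesis by (simp add: nbh_def[of H] H_def del: nbh_def) (auto simp: nbh_def)
    qed
    then show ?thesis by blast
  qed
  moreover have "{e \<in> edges H. v1 \<notin> e \<and> v2 \<notin> e} = {e \<in> edges G. v \<notin> e}"
    using newE by (auto simp: H_def)
  ultimately have "split_into G H v v1 v2"
    using assms v1 v2 unfolding split_into_def n1 n2 by (auto simp: H_def)
  then show thesis using n1 n2 that by blast
qed

text \<open>If \<open>l > 0\<close>, the degree sum exceeds \<open>2 * card (verts G)\<close>, so
  some degree exceeds 2; splitting off two neighbours there leaves an even positive rest. If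
  \<open>l = 0\<close>, the degrees are at least 2 and sum up to this lower bound, so each equals
  2.\<close>

lemma exclusive_splits_exist:
  fixes G :: "'a graph"
  assumes "infinite (UNIV :: 'a set)"
    and "even_degrees G" "degree_sum G = 2 * (card (verts G) + l)"
  shows "\<exists>H. (exclusive_split ^^ l) G H \<and> two_regular H"
  using assms(2,3)
proof (induction l arbitrary: G)
  case 0
  have gr: "is_graph G" and fin: "finite (verts G)"
    using 0 by (auto simp: even_degrees_def is_graph_def)
  have ge: "2 \<le> card (nbh G v)" if "v \<in> verts G" for v
    using 0(1) that by (auto simp: even_degrees_def elim!: evenE)
  have "(\<Sum>v\<in>verts G. 2) = (\<Sum>v\<in>verts G. card (nbh G v))"
    using 0(2) by (simp add: degree_sum_def)
  then have "card (nbh G v) = 2" if "v \<in> verts G" for v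
    using sum_mono_inv[of "\<lambda>_. 2" "verts G" "\<lambda>v. card (nbh G v)" v] ge that fin by simp
  then show ?case using gr by (auto simp: two_regular_def)
next
  case (Suc l)
  have gr: "is_graph G" using Suc.prems by (simp add: even_degrees_def)
  have "\<exists>v\<in>verts G. card (nbh G v) > 2"
  proof (rule ccontr)
    assume "\<not> ?thesis"
    then have "degree_sum G \<le> (\<Sum>v\<in>verts G. 2)"
      unfolding degree_sum_def by (intro sum_mono) auto
    then show False using Suc.prems(2) by simp
  qed
  then obtain v where v: "v \<in> verts G" "card (nbh G v) > 2" by blast
  then obtain A where A: "A \<subseteq> nbh G v" "card A = 2"
    by (meson less_imp_le obtain_subset_with_card_n)
  obtain H v1 v2 where H: "split_into G H v v1 v2" "nbh H v1 = A" "nbh H v2 = nbh G v - A"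
    using split_into_exists[OF assms(1) gr v(1) A(1)] by blast
  have "card (nbh H v2) > 0" using split_degree[OF H(1)] H(2) A v by simp
  then have "even_degrees H"
    using Suc.prems(1) A H(2) by (simp add: split_even_degrees_iff[OF H(1)])
  moreover have "degree_sum H = 2 * (card (verts H) + l)"
    using Suc.prems(2) by (simp add: split_degree_sum[OF H(1)] split_card_verts[OF H(1)])
  ultimately obtain K where "(exclusive_split ^^ l) H K" "two_regular K"
    using Suc.IH by blast
  moreover have "exclusive_split G H" using H(1) by (auto simp: exclusive_split_iff)
  ultimately show ?case by (metis relpowp_Suc_I2)
qed

lemma cges_yes_iff:
  "(G, k) \<in> cges_yes \<longleftrightarrow> even_degrees G \<and> degree_sum G \<le> 2 * (card (verts G) + k)"
proof
  assume "(G, k) \<in> cges_yes"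
  then obtain l H where "l \<le> k" "(exclusive_split ^^ l) G H" "is_cycle_graph H"
    by (auto simp: cges_yes_def)
  then show "even_degrees G \<and> degree_sum G \<le> 2 * (card (verts G) + k)"
    using exclusive_split_degrees two_regular_cycle_graph by fastforce
next
  assume *: "even_degrees G \<and> degree_sum G \<le> 2 * (card (verts G) + k)"
  then have deg: "even (card (nbh G v))" "2 \<le> card (nbh G v)" if "v \<in> verts G" for v
    using that by (auto simp: even_degrees_def elim!: evenE)
  have "even (degree_sum G)" unfolding degree_sum_def by (intro dvd_sum) (use deg in auto)
  moreover have "(\<Sum>v\<in>verts G. 2) \<le> degree_sum G"
    unfolding degree_sum_def by (intro sum_mono) (use deg in auto)
  \<comment> \<open>The truncated subtraction is exact because all degrees are at least 2.\<close>
  ultimately have l: "degree_sum G = 2 * (card (verts G) + (degree_sum G div 2 - card (verts G)))"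
    by simp
  define l where "l = degree_sum G div 2 - card (verts G)"
  have l: "degree_sum G = 2 * (card (verts G) + l)" using l by (simp add: l_def)
  then obtain H where "(exclusive_split ^^ l) G H" "two_regular H"
    using l exclusive_splits_exist * by (metis infinite_UNIV_nat)
  moreover have "l \<le> k" using l * by simp
  ultimately show "(G, k) \<in> cges_yes"
    using cycle_graph_two_regular unfolding cges_yes_def by blast
qed

subsection \<open>The Turing machine\<close>

definition nth0 :: "nat list \<Rightarrow> nat \<Rightarrow> nat" where
  "nth0 xs n = (if n < length xs then xs ! n else 0)"

definition zcons :: "nat \<Rightarrow> nat list \<Rightarrow> nat list" where
  "zcons a xs = (if a = 0 \<and> xs = [] then [] else a # xs)"

lemma zcons_simps [simp]:
  "zcons 0 [] = []" "a \<noteq> 0 \<Longrightarrow> zcons a xs = a # xs" "zcons a (x # xs) = a # x # xs"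
  by (auto simp: zcons_def)

lemma tl_zcons [simp]: "tl (zcons a xs) = xs"
  by (auto simp: zcons_def)

lemma nth0_simps [simp]:
  "nth0 [] n = 0" "nth0 (a # xs) 0 = a" "nth0 (a # xs) (Suc n) = nth0 xs n"
  by (auto simp: nth0_def)

lemma nth0_zcons [simp]:
  "nth0 (zcons a xs) 0 = a" "nth0 (zcons a xs) (Suc n) = nth0 xs n"
  by (auto simp: nth0_def zcons_def)

lemma nth0_tl [simp]: "nth0 (tl xs) n = nth0 xs (Suc n)"
  by (cases xs) auto

text \<open>A pair \<open>(l, r)\<close> describes a tape relative to its head: \<open>r\<close> is read rightwards from the
  head and \<open>l\<close> leftwards from its left neighbour; all other cells are blank. The smart constructor
  \<open>zcons\<close> keeps blanks from piling up at the ends of the lists.\<close>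

type_synonym zipper = "nat list \<times> nat list"

fun ztape :: "int \<Rightarrow> zipper \<Rightarrow> tape" where
  "ztape x (l, r) = (x, \<lambda>i. if x \<le> i then nth0 r (nat (i - x)) else nth0 l (nat (x - 1 - i)))"

fun zread :: "zipper \<Rightarrow> nat" where
  "zread (l, r) = nth0 r 0"

text \<open>In the run lemmas, \<open>zleft (l, r)\<close> places the head on the cell just left of
  the boundary between \<open>l\<close> and \<open>r\<close>, without a case distinction on whether
  \<open>l\<close> is empty.\<close>

fun zleft :: "zipper \<Rightarrow> zipper" where
  "zleft (l, r) = (tl l, zcons (nth0 l 0) r)"

text \<open>The \<open>Stay\<close> case returns an unchanged zipper literally when the symbol stays
  the same; a tape that a transition leaves alone thus needs no case distinction on its
  lists.\<close>

fun zact :: "nat \<times> move \<Rightarrow> zipper \<Rightarrow> zipper" where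
  "zact (s, Left) (l, r) = zleft (l, zcons s (tl r))"
| "zact (s, Stay) (l, r) = (if s = nth0 r 0 then (l, r) else (l, zcons s (tl r)))"
| "zact (s, Right) (l, r) = (zcons s l, tl r)"

lemma read_ztape: "read (ztape x A) = zread A"
  by (cases A) simp

lemma act_ztape: "act (s, d) (ztape x A) = ztape (x + offset d) (zact (s, d) A)"
proof -
  obtain l r where A: "A = (l, r)" by (cases A)
  \<comment> \<open>Distances are brought into the form \<open>Suc\<close>, so that
    \<open>nth0\<close> can skip the head cell.\<close>
  have [simp]: "nth0 r (nat (i - x)) = nth0 r (Suc (nat (i - x - 1)))" if "x < i" for i
  proof -
    have "nat (i - x) = Suc (nat (i - x - 1))" using that by auto
    then show ?thesis by simp
  qed
  have [simp]: "nat (1 + i - x) = Suc (nat (i - x))" if "x \<le> i" for i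
    using that by auto
  have [simp]: "nat (x - i) = Suc (nat (x - 1 - i))" if "i < x" for i
    using that by auto
  have [simp]: "nat (x - 1 - i) = Suc (nat (x - 2 - i))" if "i < x - 1" for i
    using that by auto
  show ?thesis
  proof (cases d)
    case Left
    have "((\<lambda>i. if x \<le> i then nth0 r (nat (i - x)) else nth0 l (nat (x - 1 - i)))(x := s)) i =
      (if x - 1 \<le> i then nth0 (zcons (nth0 l 0) (zcons s (tl r))) (nat (i - (x - 1)))
       else nth0 (tl l) (nat (x - 1 - 1 - i)))" for i
    proof -
      consider "i < x - 1" | "i = x - 1" | "i = x" | "i > x" by linarith
      then show ?thesis
      proof cases
        case 1
        then show ?thesis by (simp add: algebra_simps)
      next
        case 4
        have "nat (i - (x - 1)) = Suc (Suc (nat (i - x - 1)))" using 4 by auto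
        then show ?thesis using 4 by simp
      qed auto
    qed
    then show ?thesis by (simp add: A Left fun_eq_iff)
  next
    case Stay
    have "nat (i - x) = Suc (nat (i - x - 1))" if "x \<le> i" "i \<noteq> x" for i
      using that by auto
    then show ?thesis by (auto simp: A Stay fun_eq_iff)
  next
    case Right
    have "((\<lambda>i. if x \<le> i then nth0 r (nat (i - x)) else nth0 l (nat (x - 1 - i)))(x := s)) i =
      (if x + 1 \<le> i then nth0 (tl r) (nat (i - (x + 1)))
       else nth0 (zcons s l) (nat (x + 1 - 1 - i)))" for i
    proof -
      consider "i < x" | "i = x" | "i > x" by linarith
      then show ?thesis
        by cases (auto simp: algebra_simps)
    qed
    then show ?thesis by (simp add: A Right fun_eq_iff)
  qed
qed

text \<open>The states: 0 and 1 read \<open>k\<close>; 2, 3 and 4 read a row, when the bits of the row so far have zero, odd, or positive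
  even sum; 5 rewinds the second tape; 6 is the beginning of a row; 7 checks the
  degrees and subtracts the number of vertices on the third tape; 8 rewinds the input; 9 moves to the end of \<open>k\<close>; 10
  decrements the unary number and 11 decrements \<open>k\<close>; 12 accepts and 13 rejects. On the second
  tape, 1, 2 and 3 stand for degrees that are zero, odd, or even and positive.\<close>

definition cges_delta :: "nat \<Rightarrow> nat \<Rightarrow> nat \<Rightarrow> nat \<Rightarrow> nat \<times> (nat \<times> move) list" where
  "cges_delta q a b c =
    (if q = 0 \<and> a = 2 then (1, [(a, Right), (b, Stay), (c, Stay)])
     else if q = 1 \<and> a \<in> {1, 2} then (1, [(a, Right), (b, Stay), (c, Stay)])
     else if q = 1 \<and> a = 3 then (6, [(a, Right), (b, Stay), (c, Stay)])
     else if q \<in> {2, 3, 4} \<and> a = 1 \<and> b \<noteq> 0 then (q, [(a, Right), (b, Right), (c, Stay)])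
     else if q \<in> {2, 3, 4} \<and> a = 2 \<and> b \<noteq> 0 then
       (if q = 3 then 4 else 3, [(a, Right), (if b = 2 then 3 else 2, Right), (1, Right)])
     else if q \<in> {2, 3, 4} \<and> a = 3 \<and> b = 0 then (5, [(a, Right), (if q = 2 then 1 else if q = 3 then 2 else 3, Left), (c, Stay)])
     else if q = 5 \<and> b \<noteq> 0 then (5, [(a, Stay), (b, Left), (c, Stay)])
     else if q = 5 then (6, [(a, Stay), (b, Right), (c, Stay)])
     else if q = 6 \<and> a \<noteq> 0 then (2, [(a, Stay), (b, Stay), (c, Stay)])
     else if q = 6 then (7, [(a, Stay), (b, Stay), (c, Stay)])
     else if q = 7 \<and> b = 3 then (7, [(a, Stay), (b, Right), (c, Left)])
     else if q = 7 \<and> b = 0 then (8, [(a, Left), (b, Stay), (c, Left)])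
     else if q = 8 \<and> a \<noteq> 0 then (8, [(a, Left), (b, Stay), (c, Stay)])
     else if q = 8 then (9, [(a, Right), (b, Stay), (c, Stay)])
     else if q = 9 \<and> a \<noteq> 3 then (9, [(a, Right), (b, Stay), (c, Stay)])
     else if q = 9 then (10, [(a, Left), (b, Stay), (c, Stay)])
     else if q = 10 \<and> c = 0 then (12, [(a, Stay), (b, Stay), (c, Stay)])
     else if q = 10 then (11, [(a, Stay), (b, Stay), (c, Left)])
     else if q = 11 \<and> a = 1 then (11, [(2, Left), (b, Stay), (c, Stay)])
     else if q = 11 \<and> a = 2 then (9, [(1, Right), (b, Stay), (c, Stay)])
     else (13, [(a, Stay), (b, Stay), (c, Stay)]))"

definition cges_tm :: tm where
  "cges_tm = \<lparr>num_tapes = 3, num_syms = 4, num_states = 14, start = 0, accept = 12, reject = 13,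
     delta = \<lambda>q ss. cges_delta q (ss ! 0) (ss ! 1) (ss ! 2)\<rparr>"

lemma cges_tm_simps [simp]:
  "num_tapes cges_tm = 3" "num_syms cges_tm = 4" "num_states cges_tm = 14" "start cges_tm = 0"
  "accept cges_tm = 12" "reject cges_tm = 13"
  "delta cges_tm q ss = cges_delta q (ss ! 0) (ss ! 1) (ss ! 2)"
  by (simp_all add: cges_tm_def)

lemma cges_delta_bounds:
  assumes "q < 14" "a < 4" "b < 4" "c < 4"
  shows "case cges_delta q a b c of (q', as) \<Rightarrow> q' < 14 \<and> length as = 3 \<and> fst ` set as \<subseteq> {..<4}"
    (is "?ok (cges_delta q a b c)")
proof -
  have branch: "?ok x \<Longrightarrow> ?ok y \<Longrightarrow> ?ok (if P then x else y)" for P x y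
    by simp
  show ?thesis
    unfolding cges_delta_def by (intro branch) (use assms in simp_all)
qed

lemma turing_machine_cges_tm: "turing_machine cges_tm"
proof -
  have "case cges_delta q (ss ! 0) (ss ! 1) (ss ! 2) of (q', as) \<Rightarrow>
      q' < 14 \<and> length as = 3 \<and> fst ` set as \<subseteq> {..<4}"
    if "q < 14" "length ss = 3" "set ss \<subseteq> {..<4}" for q ss
  proof -
    have "ss ! 0 < 4" "ss ! 1 < 4" "ss ! 2 < 4"
      using that(2,3) by (auto simp: subset_iff)
    then show ?thesis by (rule cges_delta_bounds[OF that(1)])
  qed
  then show ?thesis by (simp add: turing_machine_def)
qed

text \<open>Quantifying over the head positions makes the zippers a complete description of a configuration.\<close>

definition decides ::
    "nat \<Rightarrow> nat \<Rightarrow> zipper \<Rightarrow> zipper \<Rightarrow> zipper \<Rightarrow> bool \<Rightarrow> bool" where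
  "decides t q A B C v \<longleftrightarrow> (\<forall>x y z. \<exists>t'\<le>t.
     fst ((step cges_tm ^^ t') (q, [ztape x A, ztape y B, ztape z C])) = (if v then 12 else 13))"

lemma decides_mono: "decides t q A B C v \<Longrightarrow> t \<le> t' \<Longrightarrow> decides t' q A B C v"
  unfolding decides_def by (meson le_trans)

lemma decides_halt [simp]: "decides t 12 A B C True" "decides t 13 A B C False"
  unfolding decides_def by (auto intro!: exI[of _ 0])

text \<open>Symbolic execution backwards by one transition, on zippers alone: repeated application
  runs the machine without mentioning head positions.\<close>

lemma decides_step:
  assumes "q < 12" "0 < t" "case cges_delta q (zread A) (zread B) (zread C) of (q', ms) \<Rightarrow>
    decides (t - 1) q' (zact (ms ! 0) A) (zact (ms ! 1) B) (zact (ms ! 2) C) v \<and> length ms = 3"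
  shows "decides t q A B C v"
  unfolding decides_def
proof (intro allI)
  fix x y z
  obtain q' ms where tr: "cges_delta q (zread A) (zread B) (zread C) = (q', ms)" by fastforce
  with assms(3) have d: "decides (t - 1) q' (zact (ms ! 0) A) (zact (ms ! 1) B) (zact (ms ! 2) C) v"
    and "length ms = 3" by auto
  then obtain m0 m1 m2 where ms: "ms = [m0, m1, m2]"
    by (auto simp: numeral_3_eq_3 length_Suc_conv)
  obtain s0 d0 s1 d1 s2 d2 where m: "m0 = (s0, d0)" "m1 = (s1, d1)" "m2 = (s2, d2)"
    by (cases m0, cases m1, cases m2)
  from d ms obtain t' where t': "t' \<le> t - 1"
    "fst ((step cges_tm ^^ t') (q', [ztape (x + offset d0) (zact m0 A),
       ztape (y + offset d1) (zact m1 B), ztape (z + offset d2) (zact m2 C)])) = (if v then 12 else 13)"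
    unfolding decides_def by (auto simp: numeral_2_eq_2) blast
  have "step cges_tm (q, [ztape x A, ztape y B, ztape z C]) =
    (q', [ztape (x + offset d0) (zact m0 A),
       ztape (y + offset d1) (zact m1 B), ztape (z + offset d2) (zact m2 C)])"
    using assms(1) tr by (simp add: read_ztape numeral_2_eq_2 ms m act_ztape del: act.simps)
  then have "fst ((step cges_tm ^^ Suc t') (q, [ztape x A, ztape y B, ztape z C])) =
      (if v then 12 else 13)"
    using t'(2) by (simp add: funpow_swap1 del: step.simps)
  then show "\<exists>t'\<le>t. fst ((step cges_tm ^^ t') (q, [ztape x A, ztape y B, ztape z C])) =
      (if v then 12 else 13)"
    using t'(1) assms(2) by (intro exI[of _ "Suc t'"]) auto
qed

text \<open>Halting configurations are fixed points, so a verdict within \<open>t\<close> steps is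
  still there after exactly \<open>t\<close>.\<close>

lemma decides_start_config:
  assumes "decides t 0 ([], w) ([], []) ([], []) v"
  shows "fst ((step cges_tm ^^ t) (start_config cges_tm w)) = (if v then 12 else 13)"
proof -
  have "start_config cges_tm w = (0, [ztape 0 ([], w), ztape 0 ([], []), ztape 0 ([], [])])"
    by (auto simp: start_config_def nth0_def fun_eq_iff numeral_2_eq_2)
  with assms obtain t' where t': "t' \<le> t"
    "fst ((step cges_tm ^^ t') (start_config cges_tm w)) = (if v then 12 else 13)"
    unfolding decides_def by metis
  let ?c = "(step cges_tm ^^ t') (start_config cges_tm w)"
  have "step cges_tm ?c = ?c"
    using t'(2) by (cases ?c) (auto split: if_splits)
  then have "(step cges_tm ^^ n) ?c = ?c" for n
    by (induction n) auto
  moreover have "t = (t - t') + t'" using t'(1) by simp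
  ultimately show ?thesis using t'(2) by (metis comp_apply funpow_add)
qed

lemma bit_sym_simps [simp]: "bit_sym True = 2" "bit_sym False = 1"
  by (simp_all add: bit_sym_def)

lemma bit_sym_pos [simp]: "bit_sym b \<noteq> 0" "bit_sym b \<noteq> 3" "bit_sym b > 0"
  by (simp_all add: bit_sym_def)

lemma bit_sym_inj [simp]: "bit_sym a = bit_sym b \<longleftrightarrow> a = b"
  by (simp add: bit_sym_def)

section \<open>Binary countdown and the final check\<close>

text \<open>Least significant bit first is the order in which the head meets the bits of
  \<open>k\<close> when it moves left from the separator.\<close>

fun lsb_value :: "bool list \<Rightarrow> nat" where
  "lsb_value [] = 0"
| "lsb_value (b # bs) = of_bool b + 2 * lsb_value bs"

text \<open>The length is kept, as the machine does not erase leading zeros.\<close>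

fun decr :: "bool list \<Rightarrow> bool list" where
  "decr [] = []"
| "decr (False # bs) = True # decr bs"
| "decr (True # bs) = False # bs"

lemma length_decr [simp]: "length (decr bs) = length bs"
  by (induction bs rule: decr.induct) auto

lemma lsb_value_decr: "lsb_value (decr bs) = lsb_value bs - 1" if "lsb_value bs > 0"
  using that by (induction bs rule: decr.induct) auto

text \<open>The separator turns the head back, so state 10 starts on the least significant
  bit.\<close>

lemma decides_skip_bits:
  assumes "decides t 10 (zleft (rev (map bit_sym cs) @ l, 3 # r)) B C v"
  shows "decides (t + length cs + 1) 9 (l, map bit_sym cs @ 3 # r) B C v"
  using assms
proof (induction cs arbitrary: l)
  case Nil
  then show ?case
    by (cases B, cases C) ((intro decides_step; auto simp: cges_delta_def)+)
next
  case (Cons c cs)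
  then have "decides (t + length cs + 1) 9 (bit_sym c # l, map bit_sym cs @ 3 # r) B C v"
    by simp
  then show ?case
    by (cases B, cases C) ((intro decides_step; auto simp: cges_delta_def)+)
qed

text \<open>In the induction, \<open>cs\<close> collects the bits that the borrow has already turned
  into ones. The first one ends the borrow, and state 9 returns over \<open>cs\<close>; each bit
  costs at most a step left and a step back.\<close>

lemma decides_decrement:
  assumes "lsb_value bs > 0"
    and "decides t 10 (zleft (map bit_sym (rev cs @ decr bs), 3 # r)) B C v"
  shows "decides (t + 2 * length bs + length cs + 1) 11
    (zleft (map bit_sym bs, map bit_sym cs @ 3 # r)) B C v"
  using assms
proof (induction bs arbitrary: cs)
  case (Cons b bs)
  obtain lb rb lc rc where BC: "B = (lb, rb)" "C = (lc, rc)" by (cases B, cases C)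
  show ?case
  proof (cases b)
    case False
    have "decides (t + 2 * length bs + length (True # cs) + 1) 11
      (zleft (map bit_sym bs, map bit_sym (True # cs) @ 3 # r)) B C v"
      using Cons False by (intro Cons.IH) auto
    then have "decides (Suc (t + 2 * length bs + length (True # cs) + 1)) 11
      (zleft (map bit_sym (b # bs), map bit_sym cs @ 3 # r)) B C v"
      using False by (intro decides_step) (auto simp: cges_delta_def BC)
    then show ?thesis by (rule decides_mono) auto
  next
    case True
    then have "decides (t + length cs + 1) 9 (bit_sym False # map bit_sym bs, map bit_sym cs @ 3 # r) B C v"
      using Cons.prems by (intro decides_skip_bits) (simp add: rev_map)
    then have "decides (Suc (t + length cs + 1)) 11
      (zleft (map bit_sym (b # bs), map bit_sym cs @ 3 # r)) B C v"
      using True by (intro decides_step) (auto simp: cges_delta_def BC)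
    then show ?thesis by (rule decides_mono) auto
  qed
qed simp

text \<open>All bits are zero, so the borrow runs into the blank left of the input, where state 11
  rejects.\<close>

lemma decides_underflow:
  assumes "lsb_value bs = 0"
  shows "decides (length bs + 1) 11 (zleft (map bit_sym bs, map bit_sym cs @ 3 # r)) B C False"
  using assms
proof (induction bs arbitrary: cs)
  case Nil
  show ?case
    by (cases B, cases C, cases cs) ((intro decides_step; auto simp: cges_delta_def)+)
next
  case (Cons b bs)
  then have "decides (length bs + 1) 11 (zleft (map bit_sym bs, map bit_sym (True # cs) @ 3 # r)) B C False"
    by (intro Cons.IH) auto
  then show ?case using Cons.prems
    by (cases B, cases C) ((intro decides_step; auto simp: cges_delta_def)+)
qed

text \<open>Every one met on the third tape is paid for by a decrement. State 10 tests for the end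
  of the ones before decrementing, so equality is accepted. \<open>R\<close> is arbitrary because
  counted ones remain on the tape.\<close>

lemma decides_compare:
  "decides (d * (2 * length bs + 2) + length bs + 2) 10 (zleft (map bit_sym bs, 3 # r)) B
     (zleft (replicate d 1, R)) (d \<le> lsb_value bs)"
proof (induction d arbitrary: bs R)
  case 0
  show ?case
    by (cases B, cases "zleft (map bit_sym bs, 3 # r)", cases R)
      ((intro decides_step; auto simp: cges_delta_def)+)
next
  case (Suc d)
  obtain lb rb la ra where AB: "B = (lb, rb)" "zleft (map bit_sym bs, 3 # r) = (la, ra)"
    by (cases B, cases "zleft (map bit_sym bs, 3 # r)")
  let ?t = "Suc d * (2 * length bs + 2) + length bs + 1"
  have "decides ?t 11 (zleft (map bit_sym bs, 3 # r)) B (zleft (replicate d 1, 1 # R))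
      (Suc d \<le> lsb_value bs)"
  proof (cases "lsb_value bs > 0")
    case True
    have "decides (d * (2 * length bs + 2) + length bs + 2 + 2 * length bs + length ([] :: bool list) + 1) 11
        (zleft (map bit_sym bs, map bit_sym [] @ 3 # r)) B (zleft (replicate d 1, 1 # R))
        (d \<le> lsb_value (decr bs))"
      using True Suc[of "decr bs" "1 # R"] by (intro decides_decrement) auto
    moreover have "(d \<le> lsb_value (decr bs)) = (Suc d \<le> lsb_value bs)"
      using True by (auto simp: lsb_value_decr)
    ultimately show ?thesis by (auto elim: decides_mono)
  next
    case False
    then have "decides (length bs + 1) 11 (zleft (map bit_sym bs, map bit_sym [] @ 3 # r)) B
        (zleft (replicate d 1, 1 # R)) False"
      by (intro decides_underflow) simp
    then show ?thesis using False by (auto elim: decides_mono)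
  qed
  then have "decides (Suc ?t) 10 (zleft (map bit_sym bs, 3 # r)) B
     (zleft (replicate (Suc d) 1, R)) (Suc d \<le> lsb_value bs)"
    by (intro decides_step) (auto simp: cges_delta_def AB)
  then show ?case by (rule decides_mono) auto
qed

lemma decides_rewind_input:
  assumes "decides t 9 ([], rev l @ r) B C v" "0 \<notin> set l"
  shows "decides (t + length l + 1) 8 (zleft (l, r)) B C v"
  using assms
proof (induction l arbitrary: r)
  case Nil
  then show ?case
    by (cases B, cases C, cases r) ((intro decides_step; auto simp: cges_delta_def)+)
next
  case (Cons a l)
  then have "decides (t + length l + 1) 8 (zleft (l, a # r)) B C v"
    by (intro Cons.IH) auto
  then show ?case using Cons.prems
    by (cases B, cases C) ((intro decides_step; auto simp: cges_delta_def)+)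
qed

text \<open>The truncated subtraction is intended: when the head of the third tape has passed the left end of the ones,
  it reads blanks from then on.\<close>

lemma decides_check:
  assumes "\<And>l R. decides t 8 (zleft A) (l, []) (zleft (replicate (d - length xs) 1, R)) v"
    and "A = (la, [])" "0 \<notin> set xs"
  shows "decides (t + length xs + 1) 7 A (l, xs) (replicate d 1, R) ((\<forall>x\<in>set xs. x = 3) \<and> v)"
  using assms(1,3)
proof (induction xs arbitrary: l d R)
  case Nil
  then show ?case
    by ((intro decides_step; auto simp: cges_delta_def assms(2))+)
next
  case (Cons x xs)
  show ?case
  proof (cases "x = 3")
    case True
    have "decides (t + length xs + 1) 7 A (3 # l, xs)
        (replicate (d - 1) 1, zcons (nth0 (replicate d 1) 0) (zcons (nth0 R 0) (tl R)))
        ((\<forall>x\<in>set xs. x = 3) \<and> v)"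
      using Cons.prems by (intro Cons.IH) auto
    moreover have "tl (replicate d (1::nat)) = replicate (d - 1) 1"
      by (cases d) auto
    ultimately show ?thesis using True
      by ((intro decides_step; auto simp: cges_delta_def assms(2))+)
  next
    case False
    then show ?thesis using Cons.prems
      by ((intro decides_step; auto simp: cges_delta_def assms(2))+)
  qed
qed

section \<open>Scanning one row\<close>

text \<open>The class of \<open>d + 1\<close> depends only on the class of \<open>d\<close>, so a
  symbol per vertex can replace a counter. The values avoid 0, so that the end of the list shows as
  a blank.\<close>

definition deg_sym :: "nat \<Rightarrow> nat" where
  "deg_sym d = (if d = 0 then 1 else if odd d then 2 else 3)"

lemma deg_sym_simps [simp]: "deg_sym 0 = 1" "deg_sym (Suc d) = (if deg_sym d = 2 then 3 else 2)"
  "deg_sym d \<noteq> 0" "deg_sym d > 0"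
  by (auto simp: deg_sym_def)

lemma deg_sym_cases: "deg_sym d = 1 \<or> deg_sym d = 2 \<or> deg_sym d = 3"
  by (auto simp: deg_sym_def)

abbreviation add_bits :: "nat list \<Rightarrow> bool list \<Rightarrow> nat list" where
  "add_bits \<equiv> map2 (\<lambda>d b. d + of_bool b)"

text \<open>State \<open>Suc (deg_sym d)\<close> is 2, 3 or 4: the class of the partial row sum
  \<open>d\<close> lives in the state. At the separator it is written behind the last entry, as the
  class of the new vertex.\<close>

lemma decides_row:
  assumes "length bs = length ds"
    and "decides t 5 (3 # rev (map bit_sym bs) @ la, r)
      (zleft (rev (map deg_sym (add_bits ds bs)) @ lb, [deg_sym (d + count_list bs True)]))
      (replicate (e + count_list bs True) 1, []) v"
  shows "decides (t + length bs + 1) (Suc (deg_sym d)) (la, map bit_sym bs @ 3 # r)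
    (lb, map deg_sym ds) (replicate e 1, []) v"
  using assms
proof (induction bs ds arbitrary: la lb d e rule: list_induct2)
  case Nil
  then show ?case using deg_sym_cases[of d]
    by ((intro decides_step; auto simp: cges_delta_def)+)
next
  case (Cons b bs x ds)
  have "decides (t + length bs + 1) (Suc (deg_sym (d + of_bool b))) (bit_sym b # la, map bit_sym bs @ 3 # r)
    (deg_sym (x + of_bool b) # lb, map deg_sym ds) (replicate (e + of_bool b) 1, []) v"
    using Cons.prems by (intro Cons.IH) (auto split: if_splits)
  then show ?case using deg_sym_cases[of d]
    by (cases b) ((intro decides_step; auto simp: cges_delta_def)+)
qed

text \<open>Bits and entries are consumed in lockstep, so a malformed row shows as a separator on an
  entry, a bit on a blank, or the end of the word.\<close>

lemma decides_bad_row: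
  assumes "set u \<subseteq> {1, 2, 3}" "\<nexists>bs r. u = map bit_sym bs @ 3 # r \<and> length bs = length ds"
  shows "decides (length u + 1) (Suc (deg_sym d)) (la, u) (lb, map deg_sym ds) (replicate e 1, []) False"
  using assms
proof (induction u arbitrary: la lb ds d e)
  case Nil
  then show ?case using deg_sym_cases[of d]
    by ((intro decides_step; auto simp: cges_delta_def)+)
next
  case (Cons a u)
  show ?case
  proof (cases "a = 3 \<or> ds = []")
    case True
    \<comment> \<open>A separator with no entry left would be a well-formed end of the row.\<close>
    then have "a = 3 \<longleftrightarrow> ds \<noteq> []"
      using Cons.prems(2) by fastforce
    then show ?thesis using True Cons.prems(1) deg_sym_cases[of d]
      by (cases ds) ((intro decides_step; auto simp: cges_delta_def)+)
  next
    case False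
    then obtain x ds' where ds: "ds = x # ds'" by (cases ds) auto
    obtain b where b: "a = bit_sym b"
      using Cons.prems(1) False by (metis bit_sym_simps insert_iff list.set_intros(1) singletonD subsetD)
    have "decides (length u + 1) (Suc (deg_sym (d + of_bool b))) (bit_sym b # la, u)
        (deg_sym (x + of_bool b) # lb, map deg_sym ds') (replicate (e + of_bool b) 1, []) False"
    proof (rule Cons.IH)
      show "\<nexists>bs r. u = map bit_sym bs @ 3 # r \<and> length bs = length ds'"
      proof clarify
        fix bs r assume "u = map bit_sym bs @ 3 # r" "length bs = length ds'"
        then have "a # u = map bit_sym (b # bs) @ 3 # r \<and> length (b # bs) = length ds"
          by (simp add: b ds)
        then show False using Cons.prems(2) by blast
      qed
    qed (use Cons.prems in auto)
    then show ?thesis using deg_sym_cases[of d]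
      by (cases b) ((intro decides_step; auto simp: cges_delta_def b ds)+)
  qed
qed

lemma decides_rewind_row:
  assumes "decides t 6 A ([], rev l @ r) C v" "0 \<notin> set l"
  shows "decides (t + length l + 1) 5 A (zleft (l, r)) C v"
  using assms
proof (induction l arbitrary: r)
  case Nil
  then show ?case
    by (cases A, cases C, cases r) ((intro decides_step; auto simp: cges_delta_def)+)
next
  case (Cons a l)
  then have "decides (t + length l + 1) 5 A (zleft (l, a # r)) C v"
    by (intro Cons.IH) auto
  then show ?case using Cons.prems
    by (cases A, cases C) ((intro decides_step; auto simp: cges_delta_def)+)
qed

subsection \<open>Runs on encoded graphs\<close>

definition enc_rows :: "bool list list \<Rightarrow> nat list" where
  "enc_rows rs = concat (map (\<lambda>r. map bit_sym r @ [3]) rs)"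

text \<open>The offset \<open>n\<close> counts the rows already read, so that the property passes to
  the tail of the list.\<close>

definition triangular :: "nat \<Rightarrow> bool list list \<Rightarrow> bool" where
  "triangular n rs \<longleftrightarrow> (\<forall>i<length rs. length (rs ! i) = n + i)"

definition add_row :: "nat list \<Rightarrow> bool list \<Rightarrow> nat list" where
  "add_row ds r = add_bits ds r @ [count_list r True]"

definition ones :: "bool list list \<Rightarrow> nat" where
  "ones rs = sum_list (map (\<lambda>r. count_list r True) rs)"

text \<open>The criterion of \<open>cges_yes_iff\<close> divided by two, with \<open>e\<close> as
  the number of edges.\<close>

definition degrees_ok :: "nat \<Rightarrow> nat list \<Rightarrow> nat \<Rightarrow> bool" where
  "degrees_ok k ds e \<longleftrightarrow> (\<forall>d\<in>set ds. even d \<and> d > 0) \<and> e \<le> length ds + k"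

lemma enc_rows_simps [simp]:
  "enc_rows [] = []" "enc_rows (r # rs) = map bit_sym r @ 3 # enc_rows rs"
  by (simp_all add: enc_rows_def)

lemma triangular_simps [simp]:
  "triangular n []" "triangular n (r # rs) \<longleftrightarrow> length r = n \<and> triangular (Suc n) rs"
  by (auto simp: triangular_def All_less_Suc2)

lemma ones_simps [simp]: "ones [] = 0" "ones (r # rs) = count_list r True + ones rs"
  by (simp_all add: ones_def)

lemma length_add_row [simp]: "length r = length ds \<Longrightarrow> length (add_row ds r) = Suc (length ds)"
  by (simp add: add_row_def)

text \<open>Unique decoding: 3 is no bit symbol, so the first 3 ends the bits.\<close>

lemma bits_sep_eq_iff [simp]:
  "map bit_sym bs @ 3 # r = map bit_sym bs' @ 3 # r' \<longleftrightarrow> bs = bs' \<and> r = r'"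
proof (induction bs arbitrary: bs')
  case Nil
  show ?case by (cases bs') (auto simp: bit_sym_def)
next
  case (Cons b bs)
  then show ?case by (cases bs') (auto simp: bit_sym_def)
qed

lemma deg_sym_3 [simp]: "deg_sym d = 3 \<longleftrightarrow> even d \<and> d > 0"
  by (auto simp: deg_sym_def)

text \<open>The facts are named by state and chained from the last phase back to the first. The
  countdown makes at most \<open>e\<close> full rounds, so the bounds by the input length
  \<open>length la\<close> keep the time quadratic.\<close>

lemma decides_final:
  assumes "rev la = map bit_sym kb @ 3 # v" "0 \<notin> set v" "length ds \<le> length la" "e \<le> length la"
  shows "decides (length la * (2 * length la + 6) + 6) 6 (la, []) ([], map deg_sym ds)
    (replicate e 1, []) (degrees_ok (lsb_value (rev kb)) ds e)"
proof -
  let ?k = "length kb"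
  let ?c = "(e - length ds) * (2 * ?k + 2) + ?k + 2"
  have la: "length la = ?k + 1 + length v"
    using arg_cong[OF assms(1), of length] by simp
  have "set la = set (map bit_sym kb @ 3 # v)" using assms(1) by (metis set_rev)
  then have nz: "0 \<notin> set la" using assms(2) by (auto simp: bit_sym_def)
  have 10: "decides ?c 10 (zleft (rev (map bit_sym kb) @ [], 3 # v)) (l, [])
      (zleft (replicate (e - length ds) 1, R)) (e - length ds \<le> lsb_value (rev kb))" for l R
    using decides_compare[of "e - length ds" "rev kb" v "(l, [])" R] by (simp add: rev_map)
  have 9: "decides (?c + ?k + 1) 9 ([], rev la @ []) (l, [])
      (zleft (replicate (e - length ds) 1, R)) (e - length ds \<le> lsb_value (rev kb))" for l R
    using decides_skip_bits[OF 10] assms(1) by simp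
  have 8: "decides (?c + ?k + 1 + length la + 1) 8 (zleft (la, [])) (l, [])
      (zleft (replicate (e - length ds) 1, R)) (e - length ds \<le> lsb_value (rev kb))" for l R
    using decides_rewind_input[OF 9 nz] .
  have "decides (?c + ?k + 1 + length la + 1 + length (map deg_sym ds) + 1) 7 (la, []) ([], map deg_sym ds)
      (replicate e 1, []) ((\<forall>x\<in>set (map deg_sym ds). x = 3) \<and> e - length ds \<le> lsb_value (rev kb))"
    by (rule decides_check[OF _ refl]) (use 8 in auto)
  \<comment> \<open>\<open>e - length ds \<le> k\<close> is equivalent to
    \<open>e \<le> length ds + k\<close> even if the subtraction is truncated.\<close>
  then have 7: "decides (?c + ?k + length la + length ds + 3) 7 (la, []) ([], map deg_sym ds)
      (replicate e 1, []) (degrees_ok (lsb_value (rev kb)) ds e)"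
    by (simp add: degrees_ok_def le_diff_conv add.commute) (simp add: eval_nat_numeral)
  have "decides (?c + ?k + length la + length ds + 4) 6 (la, []) ([], map deg_sym ds)
      (replicate e 1, []) (degrees_ok (lsb_value (rev kb)) ds e)"
    using 7 by (intro decides_step; auto simp: cges_delta_def)
  moreover have "?c + ?k + length la + length ds + 4 \<le> length la * (2 * length la + 6) + 6"
  proof -
    have "(e - length ds) * (2 * ?k + 2) \<le> length la * (2 * length la + 2)"
      using assms(4) la by (intro mult_mono) auto
    then show ?thesis using la assms(3) by (simp add: algebra_simps)
  qed
  ultimately show ?thesis by (rule decides_mono)
qed

text \<open>Induction on the length of the unread part \<open>u\<close>, one row at a time. The
  bounds by \<open>length la\<close> are invariants: each new entry of \<open>ds\<close> is matched
  by a separator already read, each one counted in \<open>e\<close> by a bit.\<close>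

lemma decides_rows:
  assumes "rev la @ u = map bit_sym kb @ 3 # v" "set u \<subseteq> {1, 2, 3}"
    and "length ds \<le> length la" "e \<le> length la" "n = length la + length u"
    and "0 \<notin> set v"
  shows "decides (length u * (2 * n + 4) + n * (2 * n + 6) + 6) 6 (la, u) ([], map deg_sym ds) (replicate e 1, [])
    (\<exists>rs. u = enc_rows rs \<and> triangular (length ds) rs \<and>
       degrees_ok (lsb_value (rev kb)) (foldl add_row ds rs) (e + ones rs))"
  using assms
proof (induction "length u" arbitrary: la u ds e rule: less_induct)
  case less
  show ?case
  proof (cases "u = []")
    case True
    have nil: "[] = enc_rows rs \<longleftrightarrow> rs = []" for rs
      by (cases rs) auto
    have eq: "(\<exists>rs. u = enc_rows rs \<and> triangular (length ds) rs \<and>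
        degrees_ok (lsb_value (rev kb)) (foldl add_row ds rs) (e + ones rs)) =
        degrees_ok (lsb_value (rev kb)) ds e"
      by (simp add: True nil)
    have "decides (length la * (2 * length la + 6) + 6) 6 (la, []) ([], map deg_sym ds)
        (replicate e 1, []) (degrees_ok (lsb_value (rev kb)) ds e)"
      using less.prems True by (intro decides_final) auto
    then show ?thesis unfolding eq using less.prems(5) True by simp
  next
    case False
    show ?thesis
    proof (cases "\<exists>bs r. u = map bit_sym bs @ 3 # r \<and> length bs = length ds")
      case True
      then obtain bs r where u: "u = map bit_sym bs @ 3 # r" and len: "length bs = length ds" by blast
      let ?la = "3 # rev (map bit_sym bs) @ la"
      let ?e = "e + count_list bs True"
      let ?v = "\<exists>rs. r = enc_rows rs \<and> triangular (length (add_row ds bs)) rs \<and>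
        degrees_ok (lsb_value (rev kb)) (foldl add_row (add_row ds bs) rs) (?e + ones rs)"
      \<comment> \<open>By unique decoding, every decoding of \<open>u\<close> starts with the row
        \<open>bs\<close>.\<close>
      have eq: "(\<exists>rs. u = enc_rows rs \<and> triangular (length ds) rs \<and>
          degrees_ok (lsb_value (rev kb)) (foldl add_row ds rs) (e + ones rs)) = ?v"
      proof
        assume "\<exists>rs. u = enc_rows rs \<and> triangular (length ds) rs \<and>
          degrees_ok (lsb_value (rev kb)) (foldl add_row ds rs) (e + ones rs)"
        then obtain rs where rs: "u = enc_rows rs" "triangular (length ds) rs"
          "degrees_ok (lsb_value (rev kb)) (foldl add_row ds rs) (e + ones rs)" by blast
        then obtain rs' where "rs = bs # rs'" "r = enc_rows rs'"
          using u by (cases rs) auto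
        then show ?v using rs len by (auto simp: add.assoc)
      next
        assume ?v
        then obtain rs where "r = enc_rows rs" "triangular (length (add_row ds bs)) rs"
          "degrees_ok (lsb_value (rev kb)) (foldl add_row (add_row ds bs) rs) (?e + ones rs)" by blast
        then show "\<exists>rs. u = enc_rows rs \<and> triangular (length ds) rs \<and>
          degrees_ok (lsb_value (rev kb)) (foldl add_row ds rs) (e + ones rs)"
          using len u by (intro exI[of _ "bs # rs"]) (auto simp: add.assoc)
      qed
      let ?t = "length r * (2 * n + 4) + n * (2 * n + 6) + 6"
      have cnt: "count_list bs True \<le> length bs" by (rule count_le_length)
      have "decides ?t 6 (?la, r) ([], map deg_sym (add_row ds bs)) (replicate ?e 1, []) ?v"
      proof (rule less.hyps)
        show "rev ?la @ r = map bit_sym kb @ 3 # v" using less.prems(1) u by simp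
      qed (use less.prems u len cnt in auto)
      \<comment> \<open>Rephrased to match \<open>decides_rewind_row\<close> and
        \<open>decides_row\<close>; a row starts with partial sum 0, which is state 2.\<close>
      then have "decides ?t 6 (?la, r) ([], rev (rev (map deg_sym (add_bits ds bs)) @ []) @
          [deg_sym (0 + count_list bs True)]) (replicate ?e 1, []) ?v"
        by (simp add: add_row_def)
      then have "decides (?t + length (rev (map deg_sym (add_bits ds bs)) @ []) + 1) 5 (?la, r)
          (zleft (rev (map deg_sym (add_bits ds bs)) @ [], [deg_sym (0 + count_list bs True)]))
          (replicate ?e 1, []) ?v"
        by (rule decides_rewind_row) auto
      then have "decides (?t + length (rev (map deg_sym (add_bits ds bs)) @ []) + 1 + length bs + 1)
          (Suc (deg_sym 0)) (la, map bit_sym bs @ 3 # r) ([], map deg_sym ds) (replicate e 1, []) ?v"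
        by (rule decides_row[OF len])
      moreover have "Suc (deg_sym 0) = 2" by simp
      moreover have "?t + length (rev (map deg_sym (add_bits ds bs)) @ []) + 1 + length bs + 1 =
          ?t + 2 * length ds + 2"
        using len by simp
      ultimately have 2: "decides (?t + 2 * length ds + 2) 2 (la, u) ([], map deg_sym ds)
          (replicate e 1, []) ?v"
        unfolding u by metis
      have "nth0 u 0 \<noteq> 0" unfolding u by (cases bs) auto
      then have "decides (?t + 2 * length ds + 3) 6 (la, u) ([], map deg_sym ds) (replicate e 1, []) ?v"
        using 2 \<open>nth0 u 0 \<noteq> 0\<close> by (intro decides_step) (auto simp: cges_delta_def)
      \<comment> \<open>The share \<open>2 * n + 4\<close> of the separator alone pays for scanning
        and rewinding, as \<open>length ds \<le> n\<close>.\<close>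
      moreover have "?t + 2 * length ds + 3 \<le> length u * (2 * n + 4) + n * (2 * n + 6) + 6"
        using less.prems(3,5) by (simp add: u algebra_simps)
      ultimately show ?thesis unfolding eq by (rule decides_mono)
    next
      case bad: False
      have eq: "(\<exists>rs. u = enc_rows rs \<and> triangular (length ds) rs \<and>
          degrees_ok (lsb_value (rev kb)) (foldl add_row ds rs) (e + ones rs)) = False"
      proof -
        have "\<not> triangular (length ds) rs" if "u = enc_rows rs" for rs
          using that bad False by (cases rs) auto
        then show ?thesis by blast
      qed
      have "decides (length u + 1) (Suc (deg_sym 0)) (la, u) ([], map deg_sym ds) (replicate e 1, []) False"
        using less.prems(2) bad by (rule decides_bad_row)
      then have 2: "decides (length u + 1) 2 (la, u) ([], map deg_sym ds) (replicate e 1, []) False"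
        by (simp add: numeral_2_eq_2)
      obtain a u' where u: "u = a # u'" using False by (cases u) auto
      then have "a \<noteq> 0" using less.prems(2) by auto
      then have "decides (length u + 2) 6 (la, u) ([], map deg_sym ds) (replicate e 1, []) False"
        using 2 by (intro decides_step) (auto simp: cges_delta_def u)
      moreover have "length u + 2 \<le> length u * (2 * n + 4) + n * (2 * n + 6) + 6"
        by (simp add: algebra_simps)
      ultimately show ?thesis unfolding eq by (rule decides_mono)
    qed
  qed
qed

lemma decides_budget:
  assumes "decides t 6 (3 # rev (map bit_sym bs) @ la, r) B C v"
  shows "decides (t + length bs + 1) 1 (la, map bit_sym bs @ 3 # r) B C v"
  using assms
proof (induction bs arbitrary: la)
  case Nil
  then show ?case
    by (cases B, cases C) (intro decides_step; auto simp: cges_delta_def)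
next
  case (Cons b bs)
  then have "decides (t + length bs + 1) 1 (bit_sym b # la, map bit_sym bs @ 3 # r) B C v"
    by simp
  then show ?case
    by (cases b; cases B; cases C) (intro decides_step; auto simp: cges_delta_def)+
qed

lemma decides_bad_budget:
  assumes "\<nexists>bs r. u = map bit_sym bs @ 3 # r" "set u \<subseteq> {1, 2, 3}"
  shows "decides (length u + 1) 1 (la, u) B C False"
  using assms
proof (induction u arbitrary: la)
  case Nil
  then show ?case
    by (cases B, cases C) (intro decides_step; auto simp: cges_delta_def)
next
  case (Cons a u)
  have "a \<noteq> 3" using Cons.prems(1) by (metis append_Nil list.simps(8))
  then obtain b where b: "a = bit_sym b"
    using Cons.prems(2) by (metis bit_sym_simps insert_iff list.set_intros(1) singletonD subsetD)
  have "\<nexists>bs r. u = map bit_sym bs @ 3 # r"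
    using Cons.prems(1) b by (metis append_Cons list.simps(9))
  then have "decides (length u + 1) 1 (a # la, u) B C False"
    using Cons by auto
  then show ?case
    using b by (cases b; cases B; cases C) (intro decides_step; auto simp: cges_delta_def)+
qed

text \<open>The verdict on arbitrary words, without reference to graphs. The leading
  \<open>True\<close> makes \<open>k\<close> positive and excludes leading zeros.\<close>

definition accepted :: "nat list \<Rightarrow> bool" where
  "accepted w \<longleftrightarrow> (\<exists>kb rs. w = map bit_sym (True # kb) @ 3 # enc_rows rs \<and> triangular 0 rs \<and>
     degrees_ok (lsb_value (rev (True # kb))) (foldl add_row [] rs) (ones rs))"

lemma decides_word:
  assumes "set w \<subseteq> {1, 2, 3}"
  shows "decides (poly [:20, 20, 20:] (length w)) 0 ([], w) ([], []) ([], []) (accepted w)"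
proof (cases "\<exists>u. w = 2 # u")
  case False
  then have "\<not> accepted w" by (auto simp: accepted_def)
  then show ?thesis using False
    by (cases w) (intro decides_step; auto simp: cges_delta_def)+
next
  case True
  then obtain u where w: "w = 2 # u" by blast
  have "decides (length w * (2 * length w + 4) + length w * (2 * length w + 6) + 6 + length w + 1) 1
      ([2], u) ([], []) ([], []) (accepted w)"
  proof (cases "\<exists>bs r. u = map bit_sym bs @ 3 # r")
    case True
    then obtain bs r where u: "u = map bit_sym bs @ 3 # r" by blast
    have acc: "accepted w \<longleftrightarrow> (\<exists>rs. r = enc_rows rs \<and> triangular (length ([] :: nat list)) rs \<and>
        degrees_ok (lsb_value (rev (True # bs))) (foldl add_row [] rs) (0 + ones rs))"
      by (auto simp: accepted_def w u)
    have "decides (length r * (2 * length w + 4) + length w * (2 * length w + 6) + 6) 6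
        (3 # rev (map bit_sym bs) @ [2], r) ([], map deg_sym []) (replicate 0 1, []) (accepted w)"
      unfolding acc
      by (rule decides_rows[where v = r]) (use assms in \<open>auto simp: w u\<close>)
    then have "decides (length r * (2 * length w + 4) + length w * (2 * length w + 6) + 6 + length bs + 1) 1
        ([2], u) ([], []) ([], []) (accepted w)"
      unfolding u by (intro decides_budget) simp
    then show ?thesis
      by (rule decides_mono) (simp add: w u algebra_simps)
  next
    case False
    then have "\<not> accepted w" by (auto simp: accepted_def w)
    moreover have "decides (length u + 1) 1 ([2], u) ([], []) ([], []) False"
      using False assms by (intro decides_bad_budget) (auto simp: w)
    ultimately show ?thesis
      by (auto elim!: decides_mono simp: w)
  qed
  \<comment> \<open>With \<open>n\<close> for \<open>length w\<close>, this is 4 n^2 + 11 n + 8; the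
    coefficients 20 are a generous rounding.\<close>
  then have "decides (length w * (2 * length w + 4) + length w * (2 * length w + 6) + 6 + length w + 2) 0
      ([], w) ([], []) ([], []) (accepted w)"
    by (intro decides_step) (auto simp: cges_delta_def w)
  then show ?thesis
    by (rule decides_mono) (simp add: algebra_simps)
qed

section \<open>Encodings of numbers and graphs\<close>

lemma binary_1 [simp]: "binary (Suc 0) = [2]"
  by (simp add: binary.simps[of "Suc 0"] binary.simps[of 0])

lemma binary_exists:
  "k > 0 \<Longrightarrow> \<exists>kb. binary k = map bit_sym (True # kb) \<and> lsb_value (rev (True # kb)) = k"
proof (induction k rule: less_induct)
  case (less k)
  show ?case
  proof (cases "k = 1")
    case True
    then show ?thesis by (intro exI[of _ "[]"]) simp
  next
    case False
    then obtain kb where "binary (k div 2) = map bit_sym (True # kb)" "lsb_value (rev (True # kb)) = k div 2"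
      using less.IH[of "k div 2"] less.prems by auto
    then show ?thesis using less.prems
      by (intro exI[of _ "kb @ [odd k]"]) (simp add: binary.simps[of k])
  qed
qed

lemma lsb_value_pos: "lsb_value (rev (True # kb)) > 0"
  by (induction kb rule: rev_induct) auto

text \<open>The converse of \<open>binary_exists\<close>, for reading an accepted word as an
  encoding.\<close>

lemma binary_lsb_value: "binary (lsb_value (rev (True # kb))) = map bit_sym (True # kb)"
proof (induction kb rule: rev_induct)
  case Nil
  show ?case by simp
next
  case (snoc b kb)
  then show ?case using lsb_value_pos[of kb]
    by (subst binary.simps) auto
qed

definition matrix :: "(nat \<Rightarrow> nat \<Rightarrow> bool) \<Rightarrow> nat \<Rightarrow> bool list list" where
  "matrix adj n = map (\<lambda>i. map (adj i) [0..<i]) [0..<n]"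

lemma triangular_matrix: "triangular 0 (matrix adj n)"
  by (simp add: triangular_def matrix_def)

lemma matrix_surj:
  assumes "triangular 0 rs"
  shows "matrix (\<lambda>i j. rs ! i ! j) (length rs) = rs"
  using assms by (intro nth_equalityI) (auto simp: matrix_def triangular_def intro!: nth_equalityI)

lemma count_list_map_upt: "count_list (map P [0..<m]) True = card {j. j < m \<and> P j}"
proof (induction m)
  case (Suc m)
  have "{j. j < Suc m \<and> P j} = (if P m then insert m else id) {j. j < m \<and> P j}"
    by (auto simp: less_Suc_eq)
  then show ?case using Suc by simp
qed simp

text \<open>After \<open>m\<close> rows the list holds the degrees in the subgraph on the first
  \<open>m\<close> vertices. By symmetry, row \<open>m\<close> also gives the increments of the
  earlier degrees; by irreflexivity, its sum is the whole degree of vertex \<open>m\<close> so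
  far.\<close>

lemma foldl_add_row_matrix:
  assumes sym: "\<And>i j. adj i j \<longleftrightarrow> adj j i" and irrefl: "\<And>i. \<not> adj i i"
  shows "foldl add_row [] (matrix adj m) = map (\<lambda>i. card {j. j < m \<and> adj i j}) [0..<m]"
proof (induction m)
  case 0
  show ?case by (simp add: matrix_def)
next
  case (Suc m)
  have card_Suc: "card {j. j < Suc m \<and> adj i j} = card {j. j < m \<and> adj i j} + of_bool (adj m i)" for i
  proof -
    have "{j. j < Suc m \<and> adj i j} = (if adj m i then insert m else id) {j. j < m \<and> adj i j}"
      using sym by (auto simp: less_Suc_eq)
    then show ?thesis by simp
  qed
  have "matrix adj (Suc m) = matrix adj m @ [map (adj m) [0..<m]]"
    by (simp add: matrix_def)
  then have "foldl add_row [] (matrix adj (Suc m)) =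
      add_row (map (\<lambda>i. card {j. j < m \<and> adj i j}) [0..<m]) (map (adj m) [0..<m])"
    using Suc by simp
  also have "\<dots> = map (\<lambda>i. card {j. j < Suc m \<and> adj i j}) [0..<Suc m]"
    using irrefl by (auto simp: add_row_def card_Suc count_list_map_upt intro!: nth_equalityI)
  finally show ?case .
qed

lemma sum_list_add_bits:
  "length r = length ds \<Longrightarrow> sum_list (add_bits ds r) = sum_list ds + count_list r True"
  by (induction r ds rule: list_induct2) auto

text \<open>The handshake lemma: a one in a row raises the degree of an earlier vertex and that of
  the new vertex.\<close>

lemma sum_list_foldl_add_row:
  "triangular (length ds) rs \<Longrightarrow> sum_list (foldl add_row ds rs) = sum_list ds + 2 * ones rs"
  by (induction rs arbitrary: ds) (auto simp: add_row_def sum_list_add_bits)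

lemma accepted_encode_iff:
  assumes "is_graph G" "k > 0"
  shows "accepted (cges_encode (G, k)) \<longleftrightarrow> (G, k) \<in> cges_yes"
proof -
  define vs where "vs = sorted_list_of_set (verts G)"
  define n where "n = length vs"
  define adj where "adj = (\<lambda>i j. {vs ! i, vs ! j} \<in> edges G)"
  define rs where "rs = matrix adj n"
  obtain kb where kb: "binary k = map bit_sym (True # kb)" "lsb_value (rev (True # kb)) = k"
    using binary_exists[OF assms(2)] by blast
  have fin: "finite (verts G)" using assms(1) by (simp add: is_graph_def)
  then have vs: "distinct vs" "set vs = verts G" by (simp_all add: vs_def)
  have card: "card (verts G) = n" using distinct_card[OF vs(1)] vs(2) by (simp add: n_def)
  have "encode_graph G = enc_rows rs"
    by (simp add: encode_graph_def Let_def enc_rows_def rs_def matrix_def vs_def n_def adj_def comp_def)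
  then have enc: "cges_encode (G, k) = map bit_sym (True # kb) @ 3 # enc_rows rs"
    by (simp add: cges_encode_def kb)
  \<comment> \<open>Unique decoding collapses the quantifier over rows in \<open>accepted\<close> to
    the matrix of \<open>G\<close>.\<close>
  have enc_inj: "rs = rs'" if "enc_rows rs = enc_rows rs'" for rs rs'
    using that
  proof (induction rs arbitrary: rs')
    case Nil
    then show ?case by (cases rs') auto
  next
    case (Cons r rs)
    then show ?case by (cases rs') auto
  qed
  have acc: "accepted (cges_encode (G, k)) \<longleftrightarrow> degrees_ok k (foldl add_row [] rs) (ones rs)"
    unfolding accepted_def enc bits_sep_eq_iff
    using enc_inj triangular_matrix[of adj n] kb(2) by (auto simp: rs_def)
  have irr: "\<not> adj i i" for i
    using assms(1) by (auto simp: adj_def is_graph_def)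
  have sym: "adj i j \<longleftrightarrow> adj j i" for i j by (simp add: adj_def insert_commute)
  have ds: "foldl add_row [] rs = map (\<lambda>i. card (nbh G (vs ! i))) [0..<n]"
  proof -
    have "card {j. j < n \<and> adj i j} = card (nbh G (vs ! i))" if "i < n" for i
    proof -
      have "nbh G (vs ! i) = (!) vs ` {j. j < n \<and> adj i j}"
      proof (intro equalityI subsetI)
        fix u assume u: "u \<in> nbh G (vs ! i)"
        then have "u \<in> set vs" using nbh_in_verts[OF assms(1)] vs(2) by blast
        then obtain j where "j < n" "u = vs ! j" by (auto simp: in_set_conv_nth n_def)
        then show "u \<in> (!) vs ` {j. j < n \<and> adj i j}"
          using u by (auto simp: nbh_def adj_def insert_commute)
      qed (auto simp: nbh_def adj_def insert_commute)
      moreover have "inj_on ((!) vs) {j. j < n \<and> adj i j}"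
        using vs(1) by (auto simp: inj_on_def n_def nth_eq_iff_index_eq)
      ultimately show ?thesis by (simp add: card_image)
    qed
    then show ?thesis unfolding rs_def foldl_add_row_matrix[of adj, OF sym irr] by simp
  qed
  also have "\<dots> = map (\<lambda>v. card (nbh G v)) vs"
    by (intro nth_equalityI) (auto simp: n_def)
  finally have ds: "foldl add_row [] rs = map (\<lambda>v. card (nbh G v)) vs" .
  have "degree_sum G = sum_list (foldl add_row [] rs)"
    using vs by (simp add: ds degree_sum_def sum_list_distinct_conv_sum_set)
  also have "\<dots> = 2 * ones rs"
    using sum_list_foldl_add_row[of "[]" rs] triangular_matrix by (simp add: rs_def)
  finally have "degree_sum G = 2 * ones rs" .
  then show ?thesis
    unfolding acc cges_yes_iff ds degrees_ok_def even_degrees_def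
    using assms(1) vs(2) card by (auto simp: n_def)
qed

text \<open>On the vertex set \<open>{..<n}\<close>, vertices coincide with their indices in the
  sorted list, so the graph read off from the rows encodes back to the same word.\<close>

lemma accepted_is_encoding:
  assumes "accepted w"
  shows "w \<in> cges_encode ` cges_instances"
proof -
  from assms obtain kb rs where w: "w = map bit_sym (True # kb) @ 3 # enc_rows rs"
    and tri: "triangular 0 rs"
    unfolding accepted_def by blast
  define k where "k = lsb_value (rev (True # kb))"
  define n where "n = length rs"
  define G :: "nat graph" where "G = ({..<n}, {{i, j} |i j. j < i \<and> i < n \<and> rs ! i ! j})"
  have "is_graph G" by (auto simp: is_graph_def G_def)
  then have "(G, k) \<in> cges_instances"
    using lsb_value_pos[of kb] by (simp add: cges_instances_def k_def)
  moreover have "encode_graph G = enc_rows rs"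
  proof -
    have "{i, j} \<in> edges G \<longleftrightarrow> rs ! i ! j" if "j < i" "i < n" for i j
      using that by (auto simp: G_def doubleton_eq_iff)
    then have rows: "map (\<lambda>i. map (\<lambda>j. bit_sym ({[0..<n] ! i, [0..<n] ! j} \<in> edges G)) [0..<i] @ [3]) [0..<n] =
      map (\<lambda>i. map bit_sym (map (\<lambda>j. rs ! i ! j) [0..<i]) @ [3]) [0..<n]"
      by auto
    have vs: "sorted_list_of_set (verts G) = [0..<n]"
      by (simp add: G_def lessThan_atLeast0)
    have "encode_graph G = enc_rows (matrix (\<lambda>i j. rs ! i ! j) n)"
      unfolding encode_graph_def Let_def vs length_upt minus_nat.diff_0 rows
      by (simp add: enc_rows_def matrix_def comp_def)
    then show ?thesis using matrix_surj[OF tri] by (simp add: n_def)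
  qed
  then have "cges_encode (G, k) = w"
    using binary_lsb_value[of kb] by (simp add: cges_encode_def w k_def)
  ultimately show ?thesis by (metis imageI)
qed

theorem theorem5:
  "polynomial_time_solvable input_alphabet cges_encode cges_instances cges_yes"
proof -
  let ?L = "{w. accepted w}"
  have "set (enc_rows rs) \<subseteq> {1, 2, 3}" for rs
    by (induction rs) (auto simp: bit_sym_def)
  then have "?L \<subseteq> lists input_alphabet"
    by (fastforce simp: accepted_def input_alphabet_def bit_sym_def)
  moreover have "fst ((step cges_tm ^^ poly [:20, 20, 20:] (length w)) (start_config cges_tm w)) =
      (if w \<in> ?L then accept cges_tm else reject cges_tm)" if "w \<in> lists input_alphabet" for w
  proof -
    have "set w \<subseteq> {1, 2, 3}" using that by (auto simp: input_alphabet_def)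
    then show ?thesis using decides_start_config[OF decides_word] by simp
  qed
  moreover have "input_alphabet \<subseteq> {1..<num_syms cges_tm}"
    by (auto simp: input_alphabet_def)
  ultimately have "polynomial_time_language input_alphabet ?L"
    unfolding polynomial_time_language_def using turing_machine_cges_tm by blast
  moreover have "?L \<subseteq> cges_encode ` cges_instances"
    using accepted_is_encoding by blast
  moreover have "\<forall>x\<in>cges_instances. cges_encode x \<in> ?L \<longleftrightarrow> x \<in> cges_yes"
    using accepted_encode_iff by (auto simp: cges_instances_def)
  ultimately show ?thesis
    unfolding polynomial_time_solvable_def by blast
qed

end
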